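(* For all integers $t \geq 4$ and $k \geq 1$, $$gr_{k}(K_{3}:P_{t}^{+})=\begin{cases}2(t-1)\cdot5^{\frac{k-2}{2}}+1 & \text{ if $k$ is even,}\\ (t-1)\cdot5^{\frac{k-1}{2}}+1 & \text{ if $k$ is odd.}\end{cases}$$
   Context: For $t \geq 3$, $P_t$ denotes the path on $t$ vertices $v_1v_2\cdots v_t$, and $P_t^{+}$ denotes the graph obtained from $P_t$ by adding the edge $v_1v_3$ (forming a triangle at one end). A coloring of the edges of a graph is rainbow if no two edges receive the same color. For a positive integer $k$ and a graph $H$, the Gallai-Ramsey number $gr_k(K_3:H)$ is the minimum integer $m$ such that every coloring of the edges of the complete graph $K_m$ using at most $k$ colors contains either a rainbow triangle or a monochromatic copy of $H$. *)

theory Defs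
  imports "HOL-Library.Ramsey"
begin

text \<open>A simple graph is a pair of a vertex set and a set of edges, each edge a set of two
  vertices; \<open>[V]\<^bsup>2\<^esup>\<close> is the set of all two-element subsets of \<open>V\<close>.\<close>

type_synonym 'a graph = "'a set \<times> 'a set set"

abbreviation verts :: "'a graph \<Rightarrow> 'a set" where "verts \<equiv> fst"
abbreviation edges :: "'a graph \<Rightarrow> 'a set set" where "edges \<equiv> snd"

definition complete_graph :: "nat \<Rightarrow> nat graph" where
  "complete_graph m = ({1..m}, [{1..m}]\<^bsup>2\<^esup>)"

definition path_graph :: "nat \<Rightarrow> nat graph" where
  "path_graph t = ({1..t}, {{i, i + 1} | i. 1 \<le> i \<and> i < t})"

text \<open>The graph \<open>P\<^sub>t\<^sup>+\<close>; it is a simple graph for \<open>t \<ge> 3\<close>.\<close>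

definition path_plus :: "nat \<Rightarrow> nat graph" where
  "path_plus t = (verts (path_graph t), insert {1, 3} (edges (path_graph t)))"

text \<open>A copy of \<open>H\<close> in \<open>G\<close> is a (not necessarily induced) subgraph of \<open>G\<close> isomorphic to \<open>H\<close>, given
  here by the isomorphism, so that its edges are the sets \<open>f ` e\<close> with \<open>e\<close> an edge of \<open>H\<close>.\<close>

definition is_copy :: "('a \<Rightarrow> 'b) \<Rightarrow> 'a graph \<Rightarrow> 'b graph \<Rightarrow> bool" where
  "is_copy f H G \<longleftrightarrow>
     inj_on f (verts H) \<and> f ` verts H \<subseteq> verts G \<and> (\<forall>e \<in> edges H. f ` e \<in> edges G)"

definition monochromatic_copy :: "('b set \<Rightarrow> 'c) \<Rightarrow> ('a \<Rightarrow> 'b) \<Rightarrow> 'a graph \<Rightarrow> 'b graph \<Rightarrow> bool" where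
  "monochromatic_copy c f H G \<longleftrightarrow> is_copy f H G \<and> (\<exists>a. \<forall>e \<in> edges H. c (f ` e) = a)"

definition rainbow_copy :: "('b set \<Rightarrow> 'c) \<Rightarrow> ('a \<Rightarrow> 'b) \<Rightarrow> 'a graph \<Rightarrow> 'b graph \<Rightarrow> bool" where
  "rainbow_copy c f H G \<longleftrightarrow> is_copy f H G \<and> inj_on (\<lambda>e. c (f ` e)) (edges H)"

definition gallai_ramsey_prop :: "nat \<Rightarrow> 'a graph \<Rightarrow> 'b graph \<Rightarrow> nat \<Rightarrow> bool" where
  "gallai_ramsey_prop k G H m \<longleftrightarrow>
     (\<forall>c :: nat set \<Rightarrow> nat. card (c ` edges (complete_graph m)) \<le> k \<longrightarrow>
        (\<exists>f. rainbow_copy c f G (complete_graph m)) \<or>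
        (\<exists>f. monochromatic_copy c f H (complete_graph m)))"

text \<open>The number \<open>gr\<^sub>k(G : H)\<close>. For a finite simple graph \<open>H\<close> the minimum exists by Ramsey's theorem,
  as shown below.\<close>

definition gallai_ramsey :: "nat \<Rightarrow> 'a graph \<Rightarrow> 'b graph \<Rightarrow> nat" where
  "gallai_ramsey k G H = (LEAST m. gallai_ramsey_prop k G H m)"

lemma gallai_ramsey_prop_exists:
  assumes "finite (verts H)" and "edges H \<subseteq> [verts H]\<^bsup>2\<^esup>"
  shows "\<exists>m. gallai_ramsey_prop k G H m"
proof -
  define n where "n = card (verts H)"
  obtain N :: nat where N: "partn_lst {..<N} (replicate k n) 2"
    using ramsey_full by blast
  have "\<exists>f. monochromatic_copy c f H (complete_graph N)"
    if c: "card (c ` edges (complete_graph N)) \<le> k" for c :: "nat set \<Rightarrow> nat"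
  proof -
    let ?E = "edges (complete_graph N)"
    have finC: "finite (c ` ?E)"
      by (simp add: complete_graph_def finite_imp_finite_nsets)
    then obtain g where g: "g ` (c ` ?E) \<subseteq> {..<k}" "inj_on g (c ` ?E)"
      using card_le_inj[of "c ` ?E" "{..<k}"] c by auto
    have Suc_E: "Suc ` e \<in> ?E" if "e \<in> [{..<N}]\<^bsup>2\<^esup>" for e
      using that unfolding complete_graph_def
      by (auto elim!: nsets2_E)
    define d where "d = (\<lambda>e. g (c (Suc ` e)))"
    have "d \<in> [{..<N}]\<^bsup>2\<^esup> \<rightarrow> {..<length (replicate k n)}"
      using g(1) Suc_E unfolding d_def by auto
    then obtain i where "i < k" "monochromatic {..<N} n 2 d i"
      using N unfolding partn_lst_def by (metis length_replicate nth_replicate)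
    then obtain K where K: "K \<in> [{..<N}]\<^bsup>n\<^esup>" and d: "d ` [K]\<^bsup>2\<^esup> \<subseteq> {i}"
      unfolding monochromatic_def by blast
    have "finite K" "card K = card (verts H)" "K \<subseteq> {..<N}"
      using K by (auto simp: nsets_def n_def)
    then obtain h where h: "bij_betw h (verts H) K"
      using assms(1) by (metis finite_same_card_bij)
    have hK: "h ` e \<in> [K]\<^bsup>2\<^esup>" if "e \<in> edges H" for e
      using bij_betwE[OF bij_betw_nsets[OF h, of 2]] that assms(2) by auto
    have KN: "[K]\<^bsup>2\<^esup> \<subseteq> [{..<N}]\<^bsup>2\<^esup>"
      using \<open>K \<subseteq> {..<N}\<close> by (rule nsets_mono)
    have copyE: "(Suc \<circ> h) ` e \<in> ?E" if "e \<in> edges H" for e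
      using Suc_E[of "h ` e"] hK[OF that] KN by (auto simp: image_comp comp_def)
    have col: "g (c ((Suc \<circ> h) ` e)) = i" if "e \<in> edges H" for e
      using d hK[OF that] by (auto simp: d_def image_comp comp_def)
    have "is_copy (Suc \<circ> h) H (complete_graph N)"
      unfolding is_copy_def
    proof (intro conjI ballI)
      show "inj_on (Suc \<circ> h) (verts H)"
        using h by (auto simp: bij_betw_def inj_on_def)
      show "(Suc \<circ> h) ` verts H \<subseteq> verts (complete_graph N)"
        using bij_betwE[OF h] \<open>K \<subseteq> {..<N}\<close> by (force simp: complete_graph_def)
    qed (rule copyE)
    moreover have "c ((Suc \<circ> h) ` e) = c ((Suc \<circ> h) ` e')"
      if "e \<in> edges H" "e' \<in> edges H" for e e'
      using col[OF that(1)] col[OF that(2)] copyE[OF that(1)] copyE[OF that(2)] g(2)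
      by (metis imageI inj_onD)
    ultimately show ?thesis
      unfolding monochromatic_copy_def by metis
  qed
  then show ?thesis
    unfolding gallai_ramsey_prop_def by blast
qed

lemma path_plus_simple:
  assumes "t \<ge> 3"
  shows "finite (verts (path_plus t))" and "edges (path_plus t) \<subseteq> [verts (path_plus t)]\<^bsup>2\<^esup>"
  using assms by (auto simp: path_plus_def path_graph_def)

end

theory Submission
  imports Defs
begin

text \<open>Put \<open>m = t - 1\<close> and call a copy of some \<open>P\<^sub>s\<^sup>+\<close> a
  lollipop. For the upper bound, let \<open>D x\<close> be the set of colors in which
  \<open>x\<close> is the end of a monochromatic lollipop, that is, in which the component of
  \<open>x\<close> has a triangle. A rotation argument in the style of Posa shows that in a graph
  without lollipops on more than \<open>m\<close> vertices, every set of vertices in components with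
  a triangle spans a graph of average degree less than \<open>m\<close>. So edges of color
  \<open>i\<close> at a vertex \<open>x\<close> with \<open>i \<in> D x\<close> are sparse, and a
  greedy choice gives a set \<open>I\<close> without such edges such that the weights
  \<open>gr_bound m (card (D x))\<close> of its vertices sum up to at least the number of all
  vertices. All monochromatic triangles are destroyed in \<open>I\<close>, and each \<open>x \<in>
  I\<close> misses the colors in \<open>D x\<close>. In a Gallai coloring without monochromatic
  triangles the sum of the weights is bounded by contracting homogeneous sets until only two colors,
  and hence at most five vertices, are left. The lower bound comes from blowing up the
  \<open>2\<close>-coloring of \<open>K\<^sub>5\<close> into two pentagons.\<close>

subsection \<open>Ends of lollipops\<close>

text \<open>\<open>J\<close> and its shift by one are disjoint subsets of \<open>{a..b}\<close> of
  equal size.\<close>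

lemma card_nonconsecutive:
  assumes "J \<subseteq> {a..<b}" and "\<And>j. j \<in> J \<Longrightarrow> Suc j \<notin> J"
  shows "2 * card J \<le> Suc b - a"
proof -
  have fin: "finite J" using assms(1) finite_subset by blast
  have "card (J \<union> Suc ` J) = card J + card (Suc ` J)"
    using fin assms(2) by (intro card_Un_disjoint) auto
  moreover have "card (Suc ` J) = card J" by (simp add: card_image)
  moreover have "card (J \<union> Suc ` J) \<le> card {a..b}"
    using assms(1) by (intro card_mono) auto
  ultimately show ?thesis by simp
qed

definition lollipop :: "('a \<Rightarrow> 'a \<Rightarrow> bool) \<Rightarrow> 'a list \<Rightarrow> bool" where
  "lollipop adj xs \<longleftrightarrow>
     distinct xs \<and> 3 \<le> length xs \<and> successively adj xs \<and> adj (xs ! 0) (xs ! 2)"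

text \<open>The end set of Posa's rotation method: the vertex set \<open>P\<close> stays fixed while
  the order along the lollipop varies.\<close>

definition lollipop_ends :: "('a \<Rightarrow> 'a \<Rightarrow> bool) \<Rightarrow> 'a set \<Rightarrow> 'a set" where
  "lollipop_ends adj P = {last xs | xs. lollipop adj xs \<and> set xs = P}"

lemma lollipop_Cons3:
  "lollipop adj (a # b # c # ys) \<longleftrightarrow>
     distinct (a # b # c # ys) \<and> adj a b \<and> adj b c \<and> adj a c \<and> successively adj (c # ys)"
  by (auto simp: lollipop_def)

lemma lollipop_cases:
  assumes "lollipop adj xs"
  obtains a b c ys where "xs = a # b # c # ys"
proof -
  have "3 \<le> length xs" using assms by (simp add: lollipop_def)
  then show thesis
    by (metis that Suc_le_length_iff numeral_3_eq_3)
qed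

lemma lollipop_take:
  assumes "lollipop adj xs" "3 \<le> n"
  shows "lollipop adj (take n xs)"
proof -
  have "successively adj (take n xs @ drop n xs)"
    using assms(1) by (simp add: lollipop_def)
  then have "successively adj (take n xs)" unfolding successively_append_iff by blast
  with assms show ?thesis by (auto simp: lollipop_def)
qed

lemma lollipop_snoc:
  assumes "lollipop adj xs" "adj (last xs) y" "y \<notin> set xs"
  shows "lollipop adj (xs @ [y])"
  using assms by (auto simp: lollipop_def successively_append_iff nth_append)

lemma lollipop_endsI:
  "lollipop adj ys \<Longrightarrow> set ys = P \<Longrightarrow> last ys = w \<Longrightarrow> w \<in> lollipop_ends adj P"
  by (auto simp: lollipop_ends_def)

context
  fixes adj :: "'a \<Rightarrow> 'a \<Rightarrow> bool"
  assumes sym: "adj x y \<Longrightarrow> adj y x"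
begin

lemma successively_flip: "successively (\<lambda>x y. adj y x) xs \<longleftrightarrow> successively adj xs"
proof -
  have "(\<lambda>x y. adj y x) = adj" by (rule ext, rule ext, rule iffI; erule sym)
  then show ?thesis by (rule arg_cong[where f = "\<lambda>r. successively r xs"])
qed

text \<open>Posa rotation: keep the part up to position \<open>j\<close> and run through the rest
  backwards, entering it at the last vertex. With \<open>j >= 2\<close> the triangle stays in the
  kept part.\<close>

lemma lollipop_rotate:
  assumes "lollipop adj xs" "2 \<le> j" "Suc j < length xs" "adj (xs ! j) (last xs)"
  shows "xs ! Suc j \<in> lollipop_ends adj (set xs)"
proof -
  define us vs where "us = take (Suc j) xs" and "vs = drop (Suc j) xs"
  have xs: "xs = us @ vs" by (simp add: us_def vs_def)
  have ne: "vs \<noteq> []" "us \<noteq> []" using assms by (auto simp: vs_def us_def)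
  have lu: "3 \<le> length us" using assms by (simp add: us_def)
  have hd: "hd vs = xs ! Suc j" using assms by (simp add: vs_def hd_drop_conv_nth)
  have lastu: "last us = xs ! j" using assms by (simp add: us_def take_Suc_conv_app_nth)
  have "successively adj us" "successively adj vs"
    using assms(1) unfolding xs lollipop_def successively_append_iff by blast+
  then have "lollipop adj (us @ rev vs)"
    using assms(1,4) ne lu lastu unfolding lollipop_def xs
    by (auto simp: successively_append_iff successively_flip nth_append hd_rev)
  moreover have "set (us @ rev vs) = set xs" by (simp add: xs)
  moreover have "last (us @ rev vs) = xs ! Suc j" using ne hd by (simp add: last_rev)
  ultimately show ?thesis by (rule lollipop_endsI)
qed

text \<open>If \<open>x\<close>, one of the first two vertices, is adjacent to the last one, the
  triangle can be passed as \<open>c, y, x\<close>; the tail is then run backwards and ends at its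
  former first vertex.\<close>

lemma lollipop_flip:
  assumes "lollipop adj xs" "4 \<le> length xs" "j < 2" "adj (xs ! j) (last xs)"
  shows "xs ! 3 \<in> lollipop_ends adj (set xs)"
proof -
  obtain a b c ys where xs: "xs = a # b # c # ys" using lollipop_cases[OF assms(1)] .
  have ne: "ys \<noteq> []" using assms(2) xs by auto
  have e: "last xs = last ys" "xs ! 3 = hd ys" using ne by (auto simp: xs hd_conv_nth numeral_3_eq_3)
  have s: "successively adj ys" "adj a b" "adj b c" "adj a c"
    using assms(1) ne unfolding xs lollipop_Cons3 by (auto simp: successively_Cons)
  have *: "lollipop adj (c # y # x # rev ys)" if "{x, y} = {a, b}" "adj x (last ys)" for x y
    using that assms(1) s s(2-4)[THEN sym] ne unfolding xs lollipop_Cons3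
    by (auto simp: successively_Cons successively_flip hd_rev doubleton_eq_iff)
  have "\<exists>x y. {x, y} = {a, b} \<and> adj x (last ys)"
    using assms(3,4) e by (cases j) (auto simp: xs)
  then obtain x y where "{x, y} = {a, b}" "adj x (last ys)" by blast
  then show ?thesis
    using ne e(2) by (intro lollipop_endsI[OF *[of x y]]) (auto simp: xs last_rev)
qed

text \<open>The last vertex \<open>e\<close> forms a second triangle with \<open>a\<close> and
  \<open>b\<close>. Starting with \<open>e, a, b\<close> ends at the former next-to-last vertex;
  starting with \<open>a, b, e\<close> and running backwards ends at \<open>c\<close>.\<close>

lemma lollipop_two_chords:
  assumes "lollipop adj xs" "4 \<le> length xs" "adj (xs ! 0) (last xs)" "adj (xs ! 1) (last xs)"
  shows "xs ! 2 \<in> lollipop_ends adj (set xs)" "xs ! (length xs - 2) \<in> lollipop_ends adj (set xs)"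
proof -
  obtain a b c ys where xs: "xs = a # b # c # ys" using lollipop_cases[OF assms(1)] .
  have "ys \<noteq> []" using assms(2) xs by auto
  then obtain zs e where ys: "ys = zs @ [e]" by (metis rev_exhaust)
  have d: "distinct (a # b # c # zs @ [e])" and adj: "adj a b" "adj b c" "adj a c" "adj a e" "adj b e"
    and s: "successively adj (c # zs @ [e])"
    using assms(1,3,4) unfolding xs ys lollipop_Cons3 by auto
  have "successively adj ((c # zs) @ [e])" using s by simp
  then have s': "successively adj (c # zs)" unfolding successively_append_iff by blast
  have "lollipop adj (e # a # b # c # zs)"
    using d adj adj(4,5)[THEN sym] s' unfolding lollipop_Cons3 by auto
  then have "last (c # zs) \<in> lollipop_ends adj (set xs)"
    by (rule lollipop_endsI) (auto simp: xs ys)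
  moreover have "xs ! (length xs - 2) = last (c # zs)"
    by (cases zs rule: rev_cases) (simp_all add: xs ys nth_append)
  ultimately show "xs ! (length xs - 2) \<in> lollipop_ends adj (set xs)" by simp
  have "successively adj (rev (c # zs @ [e]))"
    using s by (simp only: successively_rev successively_flip)
  then have "lollipop adj (a # b # e # rev zs @ [c])"
    using d adj unfolding lollipop_Cons3 by auto
  then have "c \<in> lollipop_ends adj (set xs)"
    by (rule lollipop_endsI) (auto simp: xs ys)
  then show "xs ! 2 \<in> lollipop_ends adj (set xs)" by (simp add: xs)
qed

text \<open>The last three vertices form a triangle, so the lollipop can be read from its other
  end.\<close>

lemma lollipop_reverse:
  assumes "lollipop adj xs" "4 \<le> length xs" "adj (xs ! (length xs - 3)) (last xs)"
  shows "xs ! 0 \<in> lollipop_ends adj (set xs)"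
proof -
  have "xs \<noteq> []" using assms(2) by auto
  then have "lollipop adj (rev xs)"
    using assms sym[OF assms(3)] unfolding lollipop_def
    by (auto simp: successively_flip rev_nth last_conv_nth numeral_3_eq_3)
  then show ?thesis
    by (rule lollipop_endsI) (use \<open>xs \<noteq> []\<close> in \<open>auto simp: last_rev hd_conv_nth\<close>)
qed

text \<open>The last vertex moves between two consecutive neighbours of it, which leaves its
  predecessor as the end.\<close>

lemma lollipop_insert:
  assumes "lollipop adj xs" "2 \<le> j" "Suc (Suc j) < length xs"
    "adj (xs ! j) (last xs)" "adj (xs ! Suc j) (last xs)"
  shows "xs ! (length xs - 2) \<in> lollipop_ends adj (set xs)"
proof -
  have ne: "xs \<noteq> []" using assms(3) by auto
  define us vs where "us = take (Suc j) xs" and "vs = drop (Suc j) (butlast xs)"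
  define e where "e = last xs"
  have bl: "butlast xs = us @ vs"
    using assms append_take_drop_id[of "Suc j" "butlast xs"] by (simp add: us_def vs_def take_butlast)
  have xs: "xs = us @ vs @ [e]" using ne bl e_def by (metis append_assoc append_butlast_last_id)
  have nv: "vs \<noteq> []" "us \<noteq> []" using assms by (auto simp: vs_def us_def)
  have lu: "3 \<le> length us" using assms by (simp add: us_def)
  have hd: "hd vs = xs ! Suc j" using assms by (simp add: vs_def hd_drop_conv_nth nth_butlast)
  have lastu: "last us = xs ! j" using assms by (simp add: us_def take_Suc_conv_app_nth)
  have "successively adj us" "successively adj vs"
    using assms(1) unfolding xs lollipop_def successively_append_iff by blast+
  then have "lollipop adj (us @ [e] @ vs)"
    using assms(1,4,5) sym[OF assms(5)] nv lu lastu hd unfolding lollipop_def e_def[symmetric] xs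
    by (auto simp: successively_append_iff successively_Cons nth_append)
  then have "last vs \<in> lollipop_ends adj (set xs)"
    by (rule lollipop_endsI) (auto simp: xs nv)
  moreover have "last vs = xs ! (length xs - 2)"
    using nv by (cases vs) (auto simp: xs last_conv_nth nth_append)
  ultimately show ?thesis by simp
qed

text \<open>Rotating at a neighbour of the last vertex beyond the triangle yields a new end, one for each such
  neighbour. Neighbours in the triangle can yield one end too few; in that case either one more end
  comes from reversing the lollipop or from inserting its last vertex elsewhere, or the last vertex
  has no two consecutive neighbours and hence a small degree.\<close>

lemma card_nbrs_le_card_ends:
  assumes xs: "lollipop adj xs" and irr: "\<not> adj (last xs) (last xs)"
  defines "N \<equiv> {y \<in> set xs. adj y (last xs)}"
  shows "card N \<le> card (lollipop_ends adj (set xs)) \<or> 2 * card N \<le> length xs"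
proof -
  define L where "L = length xs - 1"
  define J where "J = {j. j < L \<and> adj (xs ! j) (last xs)}"
  define E where "E = {i. i \<le> L \<and> xs ! i \<in> lollipop_ends adj (set xs)}"
  have len: "length xs = Suc L" "2 \<le> L" and dist: "distinct xs" and ne: "xs \<noteq> []"
    using xs by (auto simp: lollipop_def L_def)
  have last: "last xs = xs ! L" using ne by (simp add: last_conv_nth L_def)
  have finJ: "finite J" "finite E" by (simp_all add: J_def E_def)
  have N: "N = (!) xs ` J"
  proof (intro equalityI subsetI)
    fix y assume "y \<in> N"
    then obtain j where j: "j < Suc L" "y = xs ! j" "adj y (last xs)"
      unfolding N_def len(1)[symmetric] by (auto simp: in_set_conv_nth)
    with irr last have "j \<noteq> L" by auto
    with j show "y \<in> (!) xs ` J" by (auto simp: J_def)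
  qed (auto simp: N_def J_def len(1))
  have cN: "card N = card J"
    unfolding N using dist len(1) by (intro card_image) (auto simp: inj_on_def J_def nth_eq_iff_index_eq)
  have "lollipop_ends adj (set xs) \<subseteq> set xs"
  proof
    fix w assume "w \<in> lollipop_ends adj (set xs)"
    then obtain ys where ys: "lollipop adj ys" "set ys = set xs" "last ys = w"
      by (auto simp: lollipop_ends_def)
    then have "ys \<noteq> []" by (auto simp: lollipop_def)
    with ys show "w \<in> set xs" by (metis last_in_set)
  qed
  then have fin: "finite (lollipop_ends adj (set xs))"
    by (rule finite_subset) simp
  have cE: "card E \<le> card (lollipop_ends adj (set xs))"
    using fin dist len(1)
    by (intro card_inj_on_le[of "(!) xs"]) (auto simp: inj_on_def E_def nth_eq_iff_index_eq)
  \<comment> \<open>Rotation at each position in \<open>J'\<close> makes the next position an end,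
    so \<open>S\<close> supplies \<open>card J'\<close> ends.\<close>
  define J' where "J' = J \<inter> {2..}"
  define S where "S = Suc ` J'"
  have S: "S \<subseteq> E"
    unfolding S_def E_def J'_def J_def using lollipop_rotate[OF xs] len by auto
  have finJ': "finite J'" "finite S" using finJ by (auto simp: J'_def S_def)
  have cS: "card S = card J'" by (simp add: S_def card_image)
  have cJ: "card J = card J' + card (J \<inter> {0, 1})"
  proof -
    have "card (J' \<union> (J \<inter> {0, 1})) = card J' + card (J \<inter> {0, 1})"
      using finJ' by (intro card_Un_disjoint) (auto simp: J'_def)
    moreover have "J' \<union> (J \<inter> {0, 1}) = J" unfolding J'_def by auto
    ultimately show ?thesis by simp
  qed
  \<comment> \<open>It remains to find, for each neighbour at position 0 or 1, one more end position
    outside \<open>S\<close>.\<close>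
  have extra: "card J' + card A \<le> card E" if "A \<subseteq> E" "A \<inter> S = {}" for A
  proof -
    have "finite A" using that finJ by (auto intro: finite_subset)
    then have "card (S \<union> A) = card J' + card A"
      using that finJ' cS by (subst card_Un_disjoint) auto
    moreover have "card (S \<union> A) \<le> card E" using that S finJ by (intro card_mono) auto
    ultimately show ?thesis by simp
  qed
  have LJ: "adj (xs ! j) (last xs)" if "j \<in> J" for j using that by (simp add: J_def)
  have end3: "3 \<in> E" if "j \<in> J" "j < 2" "3 \<le> L" for j
    using lollipop_flip[OF xs _ that(2) LJ[OF that(1)]] that len by (auto simp: E_def)
  have end0: "0 \<in> E" if "L - 2 \<in> J" "3 \<le> L"
    using lollipop_reverse[OF xs] LJ[OF that(1)] that len by (auto simp: E_def)
  have end2: "2 \<in> E" "L - 1 \<in> E" if "0 \<in> J" "1 \<in> J" "3 \<le> L"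
    using lollipop_two_chords[OF xs _ LJ[OF that(1)] LJ[OF that(2)]] that len by (auto simp: E_def)
  have endL: "L - 1 \<in> E" if "j \<in> J'" "Suc j \<in> J'" for j
    using lollipop_insert[OF xs, of j] that len by (auto simp: E_def J_def J'_def)
  have S3: "i \<in> S \<longleftrightarrow> 3 \<le> i \<and> i - 1 \<in> J" for i
    unfolding S_def J'_def by (cases i) auto
  consider "J \<inter> {0, 1} = {}" | j where "J \<inter> {0, 1} = {j}" "3 \<le> L" | "{0, 1} \<subseteq> J" "3 \<le> L" | "L = 2"
    using len(2) by (cases "L = 2"; cases "0 \<in> J"; cases "1 \<in> J") (simp_all add: Int_insert_right)
  then have "card J \<le> card E \<or> 2 * card J \<le> length xs"
  proof cases
    case 1
    then show ?thesis using cJ extra[of "{}"] by simp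
  next
    case 2
    have c: "card J = Suc (card J')" using cJ 2 by simp
    have "j \<in> J \<inter> {0, 1}" unfolding 2(1) by simp
    then have j: "j \<in> J" "j < 2" by auto
    \<comment> \<open>One position outside \<open>S\<close> is wanted: 3 if 2 is not in
      \<open>J\<close>, 0 if the lollipop can be reversed, \<open>L - 1\<close> if its last vertex
      can be inserted elsewhere. Otherwise \<open>J'\<close> has no consecutive elements.\<close>
    consider "2 \<notin> J" | "L - 2 \<in> J" | i where "L - 2 \<notin> J" "i \<in> J'" "Suc i \<in> J'"
      | "\<And>i. i \<in> J' \<Longrightarrow> Suc i \<notin> J'" by blast
    then show ?thesis
    proof cases
      case 1
      then show ?thesis using extra[of "{3}"] end3[OF j 2(2)] S3 c by simp
    next
      case 2
      then show ?thesis using extra[of "{0}"] end0 S3 c \<open>3 \<le> L\<close> by simp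
    next
      case 3
      then have "L - 1 \<notin> S" by (simp add: S3 numeral_2_eq_2)
      then show ?thesis using extra[of "{L - 1}"] endL 3 c by simp
    next
      case 4
      \<comment> \<open>\<open>J'\<close> lies in \<open>{2..<L}\<close>; the single neighbour at
        position 0 or 1 accounts for the 2 subtracted here.\<close>
      have "2 * card J' \<le> Suc L - 2"
        by (rule card_nonconsecutive[OF _ 4]) (auto simp: J'_def J_def)
      then have "2 * card J \<le> length xs" using c len by linarith
      then show ?thesis ..
    qed
  next
    case 3
    have c: "card J = card J' + 2" using cJ 3 by (simp add: Int_absorb1)
    have J: "0 \<in> J" "1 \<in> J" using 3 by auto
    \<comment> \<open>Position 2 is an end outside \<open>S\<close>; a second one is needed. For
      \<open>L = 3\<close> the candidates 2 and \<open>L - 1\<close> coincide, but then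
      \<open>L - 2 = 1\<close> is in \<open>J\<close>, so 0 serves.\<close>
    have "\<exists>i. i \<in> E \<and> i \<notin> S \<and> i \<noteq> 2"
    proof -
      consider "2 \<notin> J" | "L - 2 \<in> J" | "L - 2 \<notin> J" "L \<noteq> 3" | "L = 3" by blast
      then show ?thesis
      proof cases
        case 1
        then show ?thesis using end3[OF J(1) _ 3(2)] S3 by (intro exI[of _ 3]) simp
      next
        case 2
        then show ?thesis using end0 3 S3 by (intro exI[of _ 0]) simp
      next
        case 3
        then show ?thesis using end2[OF J] S3 \<open>3 \<le> L\<close>
          by (intro exI[of _ "L - 1"]) (auto simp: numeral_2_eq_2)
      next
        case 4
        then show ?thesis using end0 J S3 by (intro exI[of _ 0]) simp
      qed
    qed
    then obtain i where "i \<in> E" "i \<notin> S" "i \<noteq> 2" by blast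
    then show ?thesis
      using extra[of "{2, i}"] end2[OF J 3(2)] S3 c by simp
  next
    case 4
    obtain a b d ys where "xs = a # b # d # ys" using lollipop_cases[OF xs] .
    then have abd: "xs = [a, b, d]" using 4 len by auto
    have s: "adj a b" "adj b d" "adj a d" "distinct [a, b, d]"
      using xs unfolding abd lollipop_Cons3 by auto
    have **: "lollipop adj [b, d, a]" and *: "lollipop adj [a, d, b]"
      unfolding lollipop_Cons3 using s s(1-3)[THEN sym] by auto
    have "a \<in> lollipop_ends adj (set xs)" by (rule lollipop_endsI[OF **]) (auto simp: abd)
    moreover have "b \<in> lollipop_ends adj (set xs)" by (rule lollipop_endsI[OF *]) (auto simp: abd)
    ultimately have "{0, 1} \<subseteq> E" using 4 by (auto simp: E_def abd)
    then have "2 \<le> card E" using card_mono[OF finJ(2), of "{0, 1}"] by simp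
    moreover have "card J \<le> 2"
      using 4 card_mono[of "{..<L}" J] by (auto simp: J_def)
    ultimately show ?thesis by simp
  qed
  then show ?thesis using cN cE by linarith
qed

end

subsection \<open>Sparseness of graphs without long lollipops\<close>

definition deg_in :: "('a \<Rightarrow> 'a \<Rightarrow> bool) \<Rightarrow> 'a set \<Rightarrow> 'a \<Rightarrow> nat" where
  "deg_in adj X x = card {y \<in> X. adj x y}"

lemma deg_in_mono: "finite Y \<Longrightarrow> X \<subseteq> Y \<Longrightarrow> deg_in adj X x \<le> deg_in adj Y x"
  unfolding deg_in_def by (intro card_mono) auto

lemma deg_in_Diff:
  assumes "finite X" "W \<subseteq> X"
  shows "deg_in adj X x = deg_in adj (X - W) x + deg_in adj W x"
proof -
  have "{y \<in> X. adj x y} = {y \<in> X - W. adj x y} \<union> {y \<in> W. adj x y}" using assms by auto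
  then show ?thesis
    using assms finite_subset[of W X] unfolding deg_in_def
    by (simp only:) (rule card_Un_disjoint; auto)
qed

lemma deg_in_eq_sum: "finite X \<Longrightarrow> deg_in adj X x = (\<Sum>y\<in>X. of_bool (adj x y))"
  unfolding deg_in_def by (simp add: of_bool_def sum.If_cases Int_def)

context
  fixes adj :: "'a \<Rightarrow> 'a \<Rightarrow> bool"
  assumes sym: "adj x y \<Longrightarrow> adj y x"
begin

text \<open>Double counting of the edges between \<open>W\<close> and \<open>X - W\<close>: what
  they contribute to the degrees in \<open>X - W\<close> is counted from the side of
  \<open>W\<close> instead.\<close>

lemma sum_deg_in_Diff:
  assumes "finite X" "W \<subseteq> X"
  shows "(\<Sum>x\<in>X. deg_in adj X x) =
    (\<Sum>x\<in>X - W. deg_in adj (X - W) x) + (\<Sum>w\<in>W. deg_in adj X w + deg_in adj (X - W) w)"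
proof -
  have W: "finite W" using assms finite_subset by blast
  have adj: "adj x y \<longleftrightarrow> adj y x" for x y using sym by blast
  have "(\<Sum>x\<in>X - W. deg_in adj W x) = (\<Sum>x\<in>X - W. \<Sum>w\<in>W. of_bool (adj x w))"
    using W by (simp add: deg_in_eq_sum)
  also have "\<dots> = (\<Sum>w\<in>W. \<Sum>x\<in>X - W. of_bool (adj w x))"
    by (subst sum.swap) (simp add: adj)
  also have "\<dots> = (\<Sum>w\<in>W. deg_in adj (X - W) w)"
    using assms by (simp add: deg_in_eq_sum)
  finally have "(\<Sum>x\<in>X - W. deg_in adj W x) = (\<Sum>w\<in>W. deg_in adj (X - W) w)" .
  moreover have "(\<Sum>x\<in>X. deg_in adj X x) = (\<Sum>x\<in>X - W. deg_in adj X x) + (\<Sum>w\<in>W. deg_in adj X w)"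
    by (rule sum.subset_diff[OF assms(2,1)])
  moreover have "(\<Sum>x\<in>X - W. deg_in adj X x) = (\<Sum>x\<in>X - W. deg_in adj (X - W) x) + (\<Sum>x\<in>X - W. deg_in adj W x)"
    using deg_in_Diff[OF assms] by (simp add: sum.distrib)
  ultimately show ?thesis by (simp add: sum.distrib)
qed

text \<open>The degree condition on \<open>W\<close> in the next lemma says that \<open>W\<close> meets at most \<open>m |W| / 2\<close> of
  the edges inside \<open>X\<close>, so that it can be removed in an induction on \<open>X\<close>.\<close>

context
  fixes m :: nat
  assumes irr: "\<not> adj x x"
    and short: "lollipop adj xs \<Longrightarrow> length xs \<le> m"
begin

lemma peel_with_lollipop:
  assumes X: "finite X" and ex: "lollipop adj xs0" "set xs0 \<subseteq> X"
  shows "\<exists>W \<subseteq> X. W \<noteq> {} \<and> (\<forall>w\<in>W. deg_in adj X w < m \<and> deg_in adj X w + deg_in adj (X - W) w \<le> m)"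
proof -
  \<comment> \<open>A longest lollipop inside \<open>X\<close>: no end of a lollipop on the same
    vertices has a further neighbour in \<open>X\<close>.\<close>
  have "\<exists>xs. (lollipop adj xs \<and> set xs \<subseteq> X) \<and> (\<forall>ys. lollipop adj ys \<and> set ys \<subseteq> X \<longrightarrow> length ys \<le> length xs)"
    by (rule ex_has_greatest_nat[where b = "Suc m"]) (use ex short in \<open>auto simp: less_Suc_eq_le\<close>)
  then obtain xs where xs: "lollipop adj xs" "set xs \<subseteq> X"
    and max: "\<And>ys. lollipop adj ys \<Longrightarrow> set ys \<subseteq> X \<Longrightarrow> length ys \<le> length xs" by blast
  define P W where "P = set xs" and "W = lollipop_ends adj P"
  have cP: "card P = length xs" "finite P" "P \<subseteq> X"
    using xs by (auto simp: P_def lollipop_def distinct_card)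
  have pm: "length xs \<le> m" "3 \<le> length xs" using short xs by (auto simp: lollipop_def)
  have lastP: "last ys \<in> P" if "lollipop adj ys" "set ys = P" for ys
  proof -
    have "ys \<noteq> []" using that by (auto simp: lollipop_def)
    then show ?thesis using that(2) by (metis last_in_set)
  qed
  have WP: "W \<subseteq> P" unfolding W_def lollipop_ends_def using lastP by auto
  have nbrs: "y \<in> P" if w: "w \<in> W" and y: "y \<in> X" "adj w y" for w y
  proof (rule ccontr)
    assume "y \<notin> P"
    obtain ys where ys: "lollipop adj ys" "set ys = P" "last ys = w"
      using w by (auto simp: W_def lollipop_ends_def)
    have "length ys = card P" using ys by (metis distinct_card lollipop_def)
    moreover have "length (ys @ [y]) \<le> length xs"
      using ys y cP \<open>y \<notin> P\<close> by (intro max lollipop_snoc) auto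
    ultimately show False using cP by simp
  qed
  have nb: "{y \<in> X. adj w y} = {y \<in> P. adj w y}" if "w \<in> W" for w
    using nbrs[OF that] cP by auto
  have dm: "deg_in adj X w < m" if w: "w \<in> W" for w
  proof -
    have "card {y \<in> P. adj w y} \<le> card (P - {w})" using cP irr by (intro card_mono) auto
    also have "\<dots> < card P" using w WP cP by (intro psubset_card_mono) auto
    finally show ?thesis using nb[OF w] cP pm by (simp add: deg_in_def)
  qed
  have out: "deg_in adj (X - W) w \<le> length xs - card W" if w: "w \<in> W" for w
  proof -
    have "{y \<in> X - W. adj w y} \<subseteq> P - W" using nbrs[OF w] by auto
    then have "deg_in adj (X - W) w \<le> card (P - W)"
      unfolding deg_in_def using cP by (intro card_mono) auto
    then show ?thesis using cP WP by (simp add: card_Diff_subset finite_subset)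
  qed
  have finW: "finite W" using WP cP finite_subset by blast
  have "last xs \<in> W" using xs by (auto simp: W_def P_def lollipop_ends_def)
  then have "W \<noteq> {}" by auto
  \<comment> \<open>A vertex of largest degree in \<open>W\<close> decides. If
    \<open>d <= card W\<close>, all of \<open>W\<close> can be removed, as \<open>out\<close> gives
    \<open>d + (length xs - card W) <= m\<close>; if \<open>2 * d <= length xs\<close>, this vertex
    alone can be removed.\<close>
  define d where "d = Max (deg_in adj X ` W)"
  have d: "deg_in adj X w \<le> d" if "w \<in> W" for w using finW that by (simp add: d_def)
  have "d \<in> deg_in adj X ` W" unfolding d_def using finW \<open>W \<noteq> {}\<close> by (intro Max_in) auto
  then obtain w0 where w0: "w0 \<in> W" "d = deg_in adj X w0" by auto
  obtain ys where ys: "lollipop adj ys" "set ys = P" "last ys = w0"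
    using w0 by (auto simp: W_def lollipop_ends_def)
  have "length ys = length xs" using ys cP by (metis distinct_card lollipop_def)
  moreover have "{y \<in> set ys. adj y (last ys)} = {y \<in> P. adj w0 y}" using ys sym by auto
  ultimately have "d \<le> card W \<or> 2 * d \<le> length xs"
    using card_nbrs_le_card_ends[OF sym ys(1) irr] ys nb[OF w0(1)] w0 by (simp add: W_def deg_in_def)
  then show ?thesis
  proof
    assume dW: "d \<le> card W"
    have "card W \<le> length xs" using WP cP card_mono by metis
    have "deg_in adj X w + deg_in adj (X - W) w \<le> m" if "w \<in> W" for w
      using d[OF that] out[OF that] dW \<open>card W \<le> length xs\<close> pm by linarith
    then show ?thesis using dm WP cP \<open>W \<noteq> {}\<close> by (intro exI[of _ W]) auto
  next
    assume "2 * d \<le> length xs"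
    moreover have "deg_in adj (X - {w0}) w0 \<le> deg_in adj X w0" using X by (intro deg_in_mono) auto
    ultimately have "deg_in adj X w0 + deg_in adj (X - {w0}) w0 \<le> m" using w0 pm by linarith
    then show ?thesis using dm[OF w0(1)] w0 WP cP by (intro exI[of _ "{w0}"]) auto
  qed
qed

text \<open>Cut a lollipop ending in \<open>X\<close> right after its first vertex in
  \<open>X\<close>. If that vertex is among the first two, use the triangle alone, with its vertices
  outside \<open>X\<close> listed first.\<close>

lemma lollipop_with_tail_in:
  assumes xs: "lollipop adj xs" "last xs \<in> X" and free: "\<And>ys. lollipop adj ys \<Longrightarrow> \<not> set ys \<subseteq> X"
  shows "\<exists>ys s. lollipop adj ys \<and> 1 \<le> s \<and> s < length ys \<and> (\<forall>j<length ys. ys ! j \<in> X \<longleftrightarrow> s \<le> j)"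
proof -
  have ne: "xs \<noteq> []" and len: "3 \<le> length xs" using xs by (auto simp: lollipop_def)
  define s where "s = (LEAST j. j < length xs \<and> xs ! j \<in> X)"
  have "length xs - 1 < length xs \<and> xs ! (length xs - 1) \<in> X"
    using xs ne by (simp add: last_conv_nth)
  then have s: "s < length xs" "xs ! s \<in> X" unfolding s_def by (metis (mono_tags, lifting) LeastI_ex)+
  have below: "xs ! j \<notin> X" if "j < s" for j
    using not_less_Least[OF that[unfolded s_def]] that s(1) by simp
  show ?thesis
  proof (cases "2 \<le> s")
    case True
    have "lollipop adj (take (Suc s) xs)" using True by (intro lollipop_take xs) auto
    moreover have "take (Suc s) xs ! j \<in> X \<longleftrightarrow> s \<le> j" if "j < length (take (Suc s) xs)" for j
      using that s below[of j] by (cases "j = s") auto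
    ultimately show ?thesis using True s by (intro exI[of _ "take (Suc s) xs"] exI[of _ s]) auto
  next
    case False
    obtain a b c zs where abc: "xs = a # b # c # zs" using lollipop_cases[OF xs(1)] .
    have t: "adj a b" "adj b c" "adj a c" "a \<noteq> b" "b \<noteq> c" "a \<noteq> c"
      using xs(1) unfolding abc lollipop_Cons3 by auto
    have tri: "lollipop adj [x, y, z]" if "{x, y, z} = {a, b, c}" for x y z
    proof -
      have "card {x, y, z} = 3" unfolding that using t by simp
      then have "x \<noteq> y" "y \<noteq> z" "x \<noteq> z" by (auto simp: card_insert_if split: if_splits)
      then have "adj x y" "adj y z" "adj x z" using that t t(1-3)[THEN sym] by (metis insertE insertI1 insertI2 singletonD)+
      then show ?thesis using \<open>x \<noteq> y\<close> \<open>y \<noteq> z\<close> \<open>x \<noteq> z\<close> by (simp add: lollipop_Cons3)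
    qed
    have notall: "\<not> {a, b, c} \<subseteq> X"
      using free[OF tri[of a b c]] by auto
    have some: "a \<in> X \<or> b \<in> X"
      using s False by (cases s) (auto simp: abc not_le less_Suc_eq)
    have "\<exists>x y z. {x, y, z} = {a, b, c} \<and> x \<notin> X \<and> z \<in> X"
      using notall some by (metis insert_commute insert_subset empty_subsetI)
    then obtain x y z where xyz: "{x, y, z} = {a, b, c}" "x \<notin> X" "z \<in> X" by blast
    have "[x, y, z] ! j \<in> X \<longleftrightarrow> (if y \<in> X then 1 else 2) \<le> j" if "j < length [x, y, z]" for j
      using that xyz by (auto simp: less_Suc_eq numeral_3_eq_3 numeral_2_eq_2)
    then show ?thesis
      using tri[OF xyz(1)] by (intro exI[of _ "[x, y, z]"] exI[of _ "if y \<in> X then 1 else 2"]) auto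
  qed
qed

text \<open>Take a longest lollipop whose vertices in \<open>X\<close> form a final segment. The
  neighbours in \<open>X\<close> of its last vertex lie on this segment, as otherwise it could be
  prolonged, and no two of them are consecutive, as \<open>X\<close> would contain a
  triangle.\<close>

lemma peel_without_lollipop:
  assumes X: "finite X" and ex: "lollipop adj xs0" "last xs0 \<in> X"
    and free: "\<And>ys. lollipop adj ys \<Longrightarrow> \<not> set ys \<subseteq> X"
  shows "\<exists>x\<in>X. 2 * deg_in adj X x \<le> m \<and> deg_in adj X x < m"
proof -
  define tail where "tail ys \<longleftrightarrow> lollipop adj ys \<and>
    (\<exists>s. 1 \<le> s \<and> s < length ys \<and> (\<forall>j<length ys. ys ! j \<in> X \<longleftrightarrow> s \<le> j))" for ys
  obtain xs1 where "tail xs1"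
    using lollipop_with_tail_in[OF ex free] unfolding tail_def by blast
  then have "\<exists>xs. tail xs \<and> (\<forall>ys. tail ys \<longrightarrow> length ys \<le> length xs)"
    by (rule ex_has_greatest_nat[where b = "Suc m"]) (use short in \<open>auto simp: tail_def less_Suc_eq_le\<close>)
  then obtain xs where xs: "tail xs" and max: "\<And>ys. tail ys \<Longrightarrow> length ys \<le> length xs" by blast
  obtain s where s: "1 \<le> s" "s < length xs" and sX: "\<And>j. j < length xs \<Longrightarrow> xs ! j \<in> X \<longleftrightarrow> s \<le> j"
    and lol: "lollipop adj xs"
    using xs unfolding tail_def by blast
  have ne: "xs \<noteq> []" using s by auto
  define L where "L = length xs - 1"
  have L: "length xs = Suc L" "last xs = xs ! L" using ne by (auto simp: L_def last_conv_nth)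
  have lastX: "last xs \<in> X" using sX s L by auto
  have inset: "y \<in> set xs" if y: "y \<in> X" "adj (last xs) y" for y
  proof (rule ccontr)
    assume "y \<notin> set xs"
    then have "lollipop adj (xs @ [y])" using lol y by (intro lollipop_snoc)
    moreover have "(xs @ [y]) ! j \<in> X \<longleftrightarrow> s \<le> j" if "j < length (xs @ [y])" for j
      using that sX[of j] y s by (auto simp: nth_append less_Suc_eq)
    ultimately have "tail (xs @ [y])" unfolding tail_def using s by (intro conjI exI[of _ s]) auto
    then show False using max[of "xs @ [y]"] by simp
  qed
  define J where "J = {j. s \<le> j \<and> j < L \<and> adj (last xs) (xs ! j)}"
  have sub: "{y \<in> X. adj (last xs) y} \<subseteq> (!) xs ` J"
  proof
    fix y assume y: "y \<in> {y \<in> X. adj (last xs) y}"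
    then obtain j where j: "j < length xs" "y = xs ! j" using inset by (auto simp: in_set_conv_nth)
    then have "s \<le> j" "j \<noteq> L" using sX y irr L(2) by auto
    then show "y \<in> (!) xs ` J" using j y L by (auto simp: J_def)
  qed
  have "finite J" by (simp add: J_def)
  then have dJ: "deg_in adj X (last xs) \<le> card J"
    unfolding deg_in_def using sub by (rule surj_card_le)
  have "Suc j \<notin> J" if "j \<in> J" for j
  proof
    assume j': "Suc j \<in> J"
    have "successively adj xs" "distinct xs" using lol by (auto simp: lollipop_def)
    then have "adj (xs ! j) (xs ! Suc j)" "xs ! j \<noteq> xs ! Suc j" "xs ! j \<noteq> last xs" "xs ! Suc j \<noteq> last xs"
      using j' L by (auto simp: J_def successively_conv_nth nth_eq_iff_index_eq)
    then have "lollipop adj [last xs, xs ! j, xs ! Suc j]"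
      using j' that by (auto simp: lollipop_Cons3 J_def)
    moreover have "set [last xs, xs ! j, xs ! Suc j] \<subseteq> X"
      using lastX sX j' that L by (auto simp: J_def)
    ultimately show False using free by blast
  qed
  then have "2 * card J \<le> Suc L - s" by (intro card_nonconsecutive) (auto simp: J_def)
  moreover have "Suc L \<le> m" "3 \<le> Suc L" using short[OF lol] lol L by (auto simp: lollipop_def)
  ultimately show ?thesis using dJ lastX s by (intro bexI[of _ "last xs"]) auto
qed

text \<open>Induction on \<open>X\<close>, removing what \<open>peel_with_lollipop\<close> or
  \<open>peel_without_lollipop\<close> provides. The lollipops in the assumption may leave
  \<open>X\<close>, so the assumption passes to \<open>X - W\<close>.\<close>

lemma sum_deg_in_less:
  assumes "finite X" "X \<noteq> {}" "\<And>x. x \<in> X \<Longrightarrow> \<exists>xs. lollipop adj xs \<and> last xs = x"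
  shows "(\<Sum>x\<in>X. deg_in adj X x) < m * card X"
  using assms
proof (induction "card X" arbitrary: X rule: less_induct)
  case less
  have "\<exists>W \<subseteq> X. W \<noteq> {} \<and> (\<forall>w\<in>W. deg_in adj X w < m \<and> deg_in adj X w + deg_in adj (X - W) w \<le> m)"
  proof (cases "\<exists>xs. lollipop adj xs \<and> set xs \<subseteq> X")
    case True
    then show ?thesis using peel_with_lollipop[OF less.prems(1)] by blast
  next
    case False
    obtain x0 xs0 where "lollipop adj xs0" "last xs0 = x0" "x0 \<in> X" using less.prems by blast
    then obtain x where x: "x \<in> X" "2 * deg_in adj X x \<le> m" "deg_in adj X x < m"
      using peel_without_lollipop[OF less.prems(1)] False by blast
    have "deg_in adj (X - {x}) x \<le> deg_in adj X x" using less.prems by (intro deg_in_mono) auto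
    then show ?thesis using x by (intro exI[of _ "{x}"]) auto
  qed
  then obtain W where W: "W \<subseteq> X" "W \<noteq> {}"
    and dW: "\<And>w. w \<in> W \<Longrightarrow> deg_in adj X w < m"
    and dW2: "\<And>w. w \<in> W \<Longrightarrow> deg_in adj X w + deg_in adj (X - W) w \<le> m" by blast
  have finW: "finite W" using W less.prems finite_subset by blast
  show ?case
  proof (cases "W = X")
    case True
    \<comment> \<open>Strictness originates here, in the last set to be removed.\<close>
    have "(\<Sum>x\<in>X. deg_in adj X x) < (\<Sum>x\<in>X. m)"
      using dW less.prems True by (intro sum_strict_mono) auto
    then show ?thesis by (simp add: mult.commute)
  next
    case False
    have "card (X - W) < card X" using W less.prems by (intro psubset_card_mono) auto
    then have IH: "(\<Sum>x\<in>X - W. deg_in adj (X - W) x) < m * card (X - W)"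
      using less.prems W False by (intro less.hyps) auto
    have "(\<Sum>w\<in>W. deg_in adj X w + deg_in adj (X - W) w) \<le> (\<Sum>w\<in>W. m)"
      using dW2 by (intro sum_mono)
    then have "(\<Sum>x\<in>X. deg_in adj X x) < m * card (X - W) + m * card W"
      using sum_deg_in_Diff[OF less.prems(1) W(1)] IH by (simp add: mult.commute)
    also have "\<dots> = m * card X"
      using W less.prems finW by (metis add_mult_distrib2 card_Diff_subset card_mono le_add_diff_inverse2)
    finally show ?thesis .
  qed
qed

end
end

subsection \<open>Homogeneous sets in Gallai colorings\<close>

definition rainbow_free :: "('a set \<Rightarrow> 'b) \<Rightarrow> 'a set \<Rightarrow> bool" where
  "rainbow_free c V \<longleftrightarrow> (\<forall>x\<in>V. \<forall>y\<in>V. \<forall>z\<in>V. x \<noteq> y \<longrightarrow> y \<noteq> z \<longrightarrow> x \<noteq> z \<longrightarrow>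
     c {x, y} = c {y, z} \<or> c {y, z} = c {x, z} \<or> c {x, y} = c {x, z})"

definition monochromatic_free :: "('a set \<Rightarrow> 'b) \<Rightarrow> 'a set \<Rightarrow> bool" where
  "monochromatic_free c V \<longleftrightarrow> (\<forall>x\<in>V. \<forall>y\<in>V. \<forall>z\<in>V. x \<noteq> y \<longrightarrow> y \<noteq> z \<longrightarrow> x \<noteq> z \<longrightarrow>
     \<not> (c {x, y} = c {y, z} \<and> c {y, z} = c {x, z}))"

definition colors_on :: "('a set \<Rightarrow> 'b) \<Rightarrow> 'a set \<Rightarrow> 'b set" where
  "colors_on c S = {c {x, y} | x y. x \<in> S \<and> y \<in> S \<and> x \<noteq> y}"

definition colors_at :: "('a set \<Rightarrow> 'b) \<Rightarrow> 'a set \<Rightarrow> 'a \<Rightarrow> 'b set" where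
  "colors_at c S x = (\<lambda>y. c {x, y}) ` (S - {x})"

definition color_rel :: "('a set \<Rightarrow> 'b) \<Rightarrow> 'a set \<Rightarrow> 'b \<Rightarrow> ('a \<times> 'a) set" where
  "color_rel c S i = {(x, y). x \<in> S \<and> y \<in> S \<and> x \<noteq> y \<and> c {x, y} = i}"

definition color_connected :: "('a set \<Rightarrow> 'b) \<Rightarrow> 'a set \<Rightarrow> 'b \<Rightarrow> bool" where
  "color_connected c S i \<longleftrightarrow> (\<forall>x\<in>S. \<forall>y\<in>S. (x, y) \<in> (color_rel c S i)\<^sup>*)"

lemma rainbow_free_mono: "rainbow_free c V \<Longrightarrow> U \<subseteq> V \<Longrightarrow> rainbow_free c U"
  unfolding rainbow_free_def by blast

lemma monochromatic_free_mono: "monochromatic_free c V \<Longrightarrow> U \<subseteq> V \<Longrightarrow> monochromatic_free c U"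
  unfolding monochromatic_free_def by blast

lemma colors_on_mono: "U \<subseteq> V \<Longrightarrow> colors_on c U \<subseteq> colors_on c V"
  unfolding colors_on_def by blast

lemma rainbow_freeD:
  assumes "rainbow_free c V" "x \<in> V" "y \<in> V" "z \<in> V" "x \<noteq> y" "y \<noteq> z" "x \<noteq> z"
    "c {x, y} \<noteq> c {y, z}" "c {x, z} \<noteq> c {y, z}"
  shows "c {x, y} = c {x, z}"
  using assms unfolding rainbow_free_def by metis

lemma color_rel_sym: "(x, y) \<in> (color_rel c S i)\<^sup>* \<Longrightarrow> (y, x) \<in> (color_rel c S i)\<^sup>*"
proof -
  have "sym (color_rel c S i)" by (auto simp: sym_def color_rel_def insert_commute)
  then show "(x, y) \<in> (color_rel c S i)\<^sup>* \<Longrightarrow> (y, x) \<in> (color_rel c S i)\<^sup>*"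
    using sym_rtrancl by (metis symD)
qed

lemma color_rel_closed: "(x, y) \<in> (color_rel c S i)\<^sup>* \<Longrightarrow> x \<in> S \<Longrightarrow> y \<in> S"
  by (induction rule: rtrancl_induct) (auto simp: color_rel_def)

text \<open>Along an edge of color \<open>i\<close> in the component of \<open>y\<close>, neither
  edge to the outside vertex \<open>x\<close> has color \<open>i\<close>, so these two agree in a
  Gallai coloring.\<close>

lemma constant_to_component:
  assumes "rainbow_free c S" "(y, z) \<in> (color_rel c S i)\<^sup>*" "x \<in> S" "y \<in> S"
    "(y, x) \<notin> (color_rel c S i)\<^sup>*"
  shows "c {x, z} = c {x, y}"
  using assms(2)
proof (induction rule: rtrancl_induct)
  case (step z w)
  have zw: "z \<in> S" "w \<in> S" "z \<noteq> w" "c {z, w} = i" using step.hyps by (auto simp: color_rel_def)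
  have yw: "(y, w) \<in> (color_rel c S i)\<^sup>*" using step.hyps by simp
  have ne: "x \<noteq> z" "x \<noteq> w" using step.hyps yw assms(5) by auto
  have "c {x, v} \<noteq> i" if "(y, v) \<in> (color_rel c S i)\<^sup>*" "v \<in> S" "x \<noteq> v" for v
  proof
    assume "c {x, v} = i"
    then have "(v, x) \<in> color_rel c S i" using that assms by (auto simp: color_rel_def insert_commute)
    then show False using that assms(5) by (meson rtrancl.rtrancl_into_rtrancl)
  qed
  then have "c {x, z} \<noteq> i" "c {x, w} \<noteq> i" using ne zw step.hyps yw by auto
  then have "c {x, z} = c {x, w}"
    using zw ne assms(3) by (intro rainbow_freeD[OF assms(1)]) auto
  then show ?case using step.IH by simp
qed simp

text \<open>A path from \<open>x\<close> either misses \<open>v\<close> or first arrives there from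
  some \<open>w\<close>, and up to \<open>w\<close> it runs in \<open>S - {v}\<close>.\<close>

lemma reach_avoiding:
  assumes "(x, y) \<in> (color_rel c S i)\<^sup>*" "x \<noteq> v" "x \<in> S"
  shows "((x, y) \<in> (color_rel c (S - {v}) i)\<^sup>* \<and> y \<noteq> v) \<or>
    (\<exists>w. (x, w) \<in> (color_rel c (S - {v}) i)\<^sup>* \<and> (w, v) \<in> color_rel c S i)"
  using assms(1)
proof (induction rule: rtrancl_induct)
  case base
  then show ?case using assms by auto
next
  case (step y z)
  show ?case
  proof (cases "z = v \<or> y = v")
    case False
    then have "(y, z) \<in> color_rel c (S - {v}) i" using step.hyps by (auto simp: color_rel_def)
    then show ?thesis using step.IH False by (meson rtrancl.rtrancl_into_rtrancl)
  next
    case True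
    then show ?thesis using step by auto
  qed
qed

text \<open>Gyarfas and Simonyi: in a Gallai coloring with at least three colors, some color class is
  disconnected. If after deleting \<open>v\<close> the color \<open>r\<close> is disconnected, then \<open>v\<close> sends an edge of
  color \<open>r\<close> to every component, so an edge of another color from \<open>v\<close> to a component fixes the color
  between that component and all others; two further colors at \<open>v\<close> are incompatible.\<close>

lemma disconnected_color:
  assumes "finite S" "rainbow_free c S" "\<not> (\<exists>a b. colors_on c S \<subseteq> {a, b})"
  shows "\<exists>i\<in>colors_on c S. \<not> color_connected c S i"
  using assms
proof (induction "card S" arbitrary: S rule: less_induct)
  case less
  show ?case
  proof (rule ccontr)
    assume "\<not> ?thesis"
    then have conn: "color_connected c S i" if "i \<in> colors_on c S" for i using that by blast
    have "colors_on c S \<noteq> {}" using less.prems(3) by auto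
    then obtain v0 where "v0 \<in> S" by (auto simp: colors_on_def)
    then obtain v where v: "v \<in> S" by blast
    define T where "T = S - {v}"
    have T: "card T < card S" "finite T" "rainbow_free c T" "T \<subseteq> S"
      using v less.prems by (auto simp: T_def intro: rainbow_free_mono intro!: card_Diff1_less simp del: card_Diff_insert)
    \<comment> \<open>Color \<open>i\<close> is connected on \<open>S\<close>, so each of its
      components on \<open>T\<close> sends an edge of color \<open>i\<close> to
      \<open>v\<close>.\<close>
    have reach_v: "\<exists>w. (u, w) \<in> (color_rel c T i)\<^sup>* \<and> w \<in> T \<and> c {v, w} = i"
      if "i \<in> colors_on c S" "u \<in> T" for i u
    proof -
      have uS: "u \<in> S" "u \<noteq> v" using that(2) by (auto simp: T_def)
      have "(u, v) \<in> (color_rel c S i)\<^sup>*"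
        using conn[OF that(1)] that(2) v by (auto simp: color_connected_def T_def)
      then obtain w where "(u, w) \<in> (color_rel c T i)\<^sup>*" "(w, v) \<in> color_rel c S i"
        using reach_avoiding[of u v c S i v] uS unfolding T_def by auto
      then show ?thesis
        by (intro exI[of _ w]) (auto simp: color_rel_def T_def insert_commute)
    qed
    have "T \<noteq> {}"
    proof
      assume "T = {}"
      then have "S = {v}" using v by (auto simp: T_def)
      then have "colors_on c S = {}" by (auto simp: colors_on_def)
      then show False using less.prems(3) by simp
    qed
    show False
    proof (cases "\<exists>a b. colors_on c T \<subseteq> {a, b}")
      case True
      then obtain a b where "colors_on c T \<subseteq> {a, b}" by blast
      then obtain g where g: "g \<in> colors_on c S" "g \<notin> colors_on c T" using less.prems(3) by blast
      \<comment> \<open>As \<open>g\<close> does not occur in \<open>T\<close>, its components there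
        are single vertices, so all edges at \<open>v\<close> have color \<open>g\<close>; by
        \<open>reach_v\<close> another color would occur at \<open>v\<close> as well.\<close>
      have "c {v, y} = g" if y: "y \<in> T" for y
      proof -
        obtain w where w: "(y, w) \<in> (color_rel c T g)\<^sup>*" "c {v, w} = g"
          using reach_v[OF g(1) y] by blast
        have "color_rel c T g = {}" using g(2) by (auto simp: color_rel_def colors_on_def)
        then show ?thesis using w by simp
      qed
      moreover obtain i where "i \<in> colors_on c S" "i \<noteq> g"
        using less.prems(3) by (metis insertCI subsetI)
      moreover obtain u where "u \<in> T" using \<open>T \<noteq> {}\<close> by blast
      ultimately show False using reach_v by metis
    next
      case False
      obtain r where r: "r \<in> colors_on c T" "\<not> color_connected c T r"
        using less.hyps[OF T(1-3) False] by blast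
      have rS: "r \<in> colors_on c S" using r colors_on_mono[OF T(4), of c] by blast
      let ?R = "(color_rel c T r)\<^sup>*"
      obtain p q where pq: "p \<in> T" "q \<in> T" "(p, q) \<notin> ?R"
        using r(2) by (auto simp: color_connected_def)
      obtain a where a: "a \<in> colors_on c S" "a \<noteq> r"
        using less.prems(3) by (metis insertCI subsetI)
      obtain b where b: "b \<in> colors_on c S" "b \<noteq> r" "b \<noteq> a"
        using less.prems(3) by (metis insertCI subsetI)
      obtain u where "u \<in> T" using \<open>T \<noteq> {}\<close> by blast
      obtain y where y: "y \<in> T" "c {v, y} = a" using reach_v[OF a(1) \<open>u \<in> T\<close>] by blast
      obtain z where z: "z \<in> T" "c {v, z} = b" using reach_v[OF b(1) \<open>u \<in> T\<close>] by blast
      \<comment> \<open>In the triangle \<open>x, w, v\<close> only \<open>{v, w}\<close> has color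
        \<open>r\<close>, since \<open>{x, w}\<close> joins different components of
        \<open>r\<close>.\<close>
      have key: "c {x, w} = c {v, x}"
        if "x \<in> T" "c {v, x} \<noteq> r" "w \<in> T" "c {v, w} = r" "(x, w) \<notin> ?R" for x w
      proof -
        have "x \<noteq> w" using that by auto
        have "c {x, w} \<noteq> r"
          using that \<open>x \<noteq> w\<close> by (auto simp: color_rel_def)
        then have "c {x, v} = c {x, w}"
          using that \<open>x \<noteq> w\<close> v T
          by (intro rainbow_freeD[OF less.prems(2)]) (auto simp: T_def insert_commute)
        then show ?thesis by (simp add: insert_commute)
      qed
      show False
      proof (cases "(y, z) \<in> ?R")
        case True
        \<comment> \<open>Here \<open>y\<close> and \<open>z\<close> share a component; a vertex
          \<open>w\<close> of another one sees it in a single color, which would be both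
          \<open>a\<close> and \<open>b\<close>.\<close>
        have "\<exists>w'. w' \<in> T \<and> (y, w') \<notin> ?R"
          using pq by (meson color_rel_sym rtrancl_trans)
        then obtain w' where w': "w' \<in> T" "(y, w') \<notin> ?R" by blast
        obtain w where w: "(w', w) \<in> ?R" "w \<in> T" "c {v, w} = r" using reach_v[OF rS w'(1)] by blast
        have yw: "(y, w) \<notin> ?R" using w w' by (meson color_rel_sym rtrancl_trans)
        then have zw: "(z, w) \<notin> ?R" using True by (meson rtrancl_trans)
        have "c {y, w} = a" using key[of y w] y a w yw by auto
        moreover have "c {z, w} = b" using key[of z w] z b w zw by auto
        moreover have "c {w, z} = c {w, y}"
          by (rule constant_to_component[OF T(3) True w(2) y(1) yw])
        ultimately show False using b(3) by (simp add: insert_commute)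
      next
        case False
        \<comment> \<open>Here \<open>y\<close> and \<open>z\<close> lie in different components,
          and the color between these would be both \<open>a\<close> and \<open>b\<close>.\<close>
        obtain wy where wy: "(y, wy) \<in> ?R" "wy \<in> T" "c {v, wy} = r" using reach_v[OF rS y(1)] by blast
        obtain wz where wz: "(z, wz) \<in> ?R" "wz \<in> T" "c {v, wz} = r" using reach_v[OF rS z(1)] by blast
        have n: "(y, wz) \<notin> ?R" "(z, wy) \<notin> ?R" "(z, y) \<notin> ?R"
          using False wy wz by (meson color_rel_sym rtrancl_trans)+
        have "c {y, wz} = a" using key[of y wz] y a wz n by auto
        moreover have "c {z, wy} = b" using key[of z wy] z b wy n by auto
        moreover have "c {y, wz} = c {y, z}"
          by (rule constant_to_component[OF T(3) wz(1) y(1) z(1) n(3)])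
        moreover have "c {z, wy} = c {z, y}"
          by (rule constant_to_component[OF T(3) wy(1) z(1) y(1) False])
        ultimately show False using b(3) by (simp add: insert_commute)
      qed
    qed
  qed
qed

text \<open>A nontrivial module. Both \<open>M\<close> and the contraction of \<open>M\<close> to
  one vertex have fewer vertices than \<open>V\<close>, as an induction requires.\<close>

definition homogeneous :: "('a set \<Rightarrow> 'b) \<Rightarrow> 'a set \<Rightarrow> 'a set \<Rightarrow> bool" where
  "homogeneous c V M \<longleftrightarrow> M \<subset> V \<and> (\<exists>x\<in>M. \<exists>y\<in>M. x \<noteq> y) \<and>
     (\<forall>x\<in>V - M. \<forall>y\<in>M. \<forall>z\<in>M. c {x, y} = c {x, z})"

text \<open>Take a component of a disconnected color that contains an edge of this color, hence two
  vertices; it is homogeneous by \<open>constant_to_component\<close>.\<close>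

lemma homogeneous_exists:
  assumes "finite V" "rainbow_free c V" "\<not> (\<exists>a b. colors_on c V \<subseteq> {a, b})"
  shows "\<exists>M. homogeneous c V M"
proof -
  obtain i where i: "i \<in> colors_on c V" "\<not> color_connected c V i"
    using disconnected_color[OF assms] by blast
  obtain x y where xy: "x \<in> V" "y \<in> V" "x \<noteq> y" "c {x, y} = i" using i(1) by (auto simp: colors_on_def)
  define M where "M = {z. (x, z) \<in> (color_rel c V i)\<^sup>*}"
  have "(x, y) \<in> color_rel c V i" using xy by (simp add: color_rel_def)
  then have "x \<in> M" "y \<in> M" by (auto simp: M_def)
  have MV: "M \<subseteq> V" using color_rel_closed xy by (fastforce simp: M_def)
  have "M \<noteq> V"
  proof
    assume "M = V"
    then have "(x, z) \<in> (color_rel c V i)\<^sup>*" if "z \<in> V" for z using that by (auto simp: M_def)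
    then show False using i(2) unfolding color_connected_def by (meson color_rel_sym rtrancl_trans)
  qed
  moreover have "c {u, z} = c {u, w}" if "u \<in> V - M" "z \<in> M" "w \<in> M" for u z w
  proof -
    have "(x, u) \<notin> (color_rel c V i)\<^sup>*" using that by (auto simp: M_def)
    then have "c {u, z} = c {u, x}" "c {u, w} = c {u, x}"
      using that xy by (intro constant_to_component[OF assms(2)]; auto simp: M_def)+
    then show ?thesis by simp
  qed
  ultimately show ?thesis
    using MV \<open>x \<in> M\<close> \<open>y \<in> M\<close> xy(3) unfolding homogeneous_def by blast
qed

subsection \<open>Gallai colorings without monochromatic triangles\<close>

text \<open>The claimed number minus one for \<open>m = t - 1\<close>, in recursive form: from one
  color on, two more colors multiply by five. The value 1 for no color is the weight of a plain
  vertex.\<close>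

fun gr_bound :: "nat \<Rightarrow> nat \<Rightarrow> nat" where
  "gr_bound m 0 = 1"
| "gr_bound m (Suc 0) = m"
| "gr_bound m (Suc (Suc 0)) = 2 * m"
| "gr_bound m (Suc (Suc (Suc k))) = 5 * gr_bound m (Suc k)"

lemma gr_bound_double: "2 \<le> m \<Longrightarrow> 2 * gr_bound m k \<le> gr_bound m (Suc k)"
  by (induction m k rule: gr_bound.induct) auto

text \<open>For \<open>k = 0\<close> this reads \<open>5 <= 2 * m\<close>, which fails for
  \<open>m = 2\<close>; here \<open>t >= 4\<close> matters.\<close>

lemma gr_bound_five: "3 \<le> m \<Longrightarrow> 5 * gr_bound m k \<le> gr_bound m (Suc (Suc k))"
  by (cases k) auto

lemma gr_bound_ge: "m * k \<le> gr_bound m k"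
  by (induction m k rule: gr_bound.induct) auto

lemma gr_bound_mono: "2 \<le> m \<Longrightarrow> j \<le> k \<Longrightarrow> gr_bound m j \<le> gr_bound m k"
proof (induction k rule: nat_induct)
  case (Suc k)
  then show ?case using gr_bound_double[of m k] by (cases "j = Suc k") auto
qed simp

lemma gr_bound_closed_form:
  "1 \<le> k \<Longrightarrow> gr_bound m k =
    (if even k then 2 * m * 5 ^ ((k - 2) div 2) else m * 5 ^ ((k - 1) div 2))"
proof (induction m k rule: gr_bound.induct)
  case (4 m k)
  show ?case
  proof (cases "even k")
    case True
    then show ?thesis using 4 by simp
  next
    case False
    then obtain j where "k = 2 * j + 1" by (rule oddE)
    then show ?thesis using 4 by simp
  qed
qed auto

lemma colors_at_subset: "x \<in> V \<Longrightarrow> colors_at c V x \<subseteq> colors_on c V"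
  by (auto simp: colors_at_def colors_on_def)

text \<open>Three such neighbours would have only color \<open>b\<close> among themselves, as color
  \<open>a\<close> would close a triangle with \<open>x\<close>: the argument for
  \<open>R(3,3) <= 6\<close>.\<close>

lemma card_color_nbrs_le_2:
  assumes "monochromatic_free c V" "finite V" "colors_on c V \<subseteq> {a, b}" "x \<in> V"
  shows "card {y \<in> V - {x}. c {x, y} = a} \<le> 2"
proof (rule ccontr)
  let ?N = "{y \<in> V - {x}. c {x, y} = a}"
  assume "\<not> ?thesis"
  then have "3 \<le> card ?N" by simp
  then obtain T where T: "T \<subseteq> ?N" "card T = 3" by (rule obtain_subset_with_card_n)
  then obtain u v w where uvw: "T = {u, v, w}" "u \<noteq> v" "v \<noteq> w" "u \<noteq> w"
    by (auto simp: card_3_iff)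
  have b: "c {p, q} = b" if "p \<in> T" "q \<in> T" "p \<noteq> q" for p q
  proof -
    have pq: "p \<in> V" "q \<in> V" "x \<noteq> p" "x \<noteq> q" "c {x, p} = a" "c {x, q} = a" using that T(1) by auto
    then have "c {p, q} \<noteq> a"
      using assms(1)[unfolded monochromatic_free_def, rule_format, of x p q] assms(4) that(3) by auto
    moreover have "c {p, q} \<in> colors_on c V" using pq that by (auto simp: colors_on_def)
    ultimately show ?thesis using assms(3) by blast
  qed
  have "u \<in> V" "v \<in> V" "w \<in> V" using T uvw by auto
  then show False
    using assms(1)[unfolded monochromatic_free_def, rule_format, of u v w] uvw
      b[of u v] b[of v w] b[of u w] by simp
qed

text \<open>The weight of a vertex is the bound for the colors that it misses, as if it had been blown up
  into an extremal coloring in these colors. Hence a homogeneous set can be contracted.\<close>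

lemma sum_gr_bound_le:
  assumes "3 \<le> m" "finite V" "rainbow_free c V" "monochromatic_free c V" "finite K" "colors_on c V \<subseteq> K"
  shows "(\<Sum>x\<in>V. gr_bound m (card (K - colors_at c V x))) \<le> gr_bound m (card K)"
  using assms(2-)
proof (induction "card V" arbitrary: V K rule: less_induct)
  case less
  note prems = less.prems
  show ?case
  proof (cases "\<exists>M. homogeneous c V M")
    case True
    then obtain M r r' where MV: "M \<subset> V" and r: "r \<in> M" "r' \<in> M" "r \<noteq> r'"
      and hom: "\<And>x y z. x \<in> V - M \<Longrightarrow> y \<in> M \<Longrightarrow> z \<in> M \<Longrightarrow> c {x, y} = c {x, z}"
      unfolding homogeneous_def by blast
    \<comment> \<open>\<open>out\<close> collects the colors leaving \<open>M\<close>, the same at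
      each vertex of \<open>M\<close>; \<open>V'\<close> contracts \<open>M\<close> to
      \<open>r\<close>.\<close>
    define out where "out = (\<lambda>x. c {r, x}) ` (V - M)"
    define V' where "V' = insert r (V - M)"
    have finM: "finite M" using MV prems(1) finite_subset by blast
    have "V' \<subset> V" using MV r by (auto simp: V'_def)
    have restrict: "card U < card V \<and> finite U \<and> rainbow_free c U \<and> monochromatic_free c U"
      if "U \<subset> V" for U
      using that prems(1-3) by (meson finite_subset monochromatic_free_mono psubset_card_mono
          psubset_imp_subset rainbow_free_mono)
    have "colors_on c V' \<subseteq> K" using colors_on_mono[of V' V c] \<open>V' \<subset> V\<close> prems(5) by blast
    note V' = restrict[OF \<open>V' \<subset> V\<close>] this
    have out_M: "c {x, y} = c {r, x}" "c {y, x} = c {r, x}" if "x \<in> V - M" "y \<in> M" for x y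
      using hom[of x y r] that r by (auto simp: insert_commute)
    have at_rest: "colors_at c V x = colors_at c V' x" if x: "x \<in> V - M" for x
    proof
      show "colors_at c V x \<subseteq> colors_at c V' x"
      proof
        fix e assume "e \<in> colors_at c V x"
        then obtain y where y: "y \<in> V" "y \<noteq> x" "e = c {x, y}" by (auto simp: colors_at_def)
        define z where "z = (if y \<in> M then r else y)"
        have "z \<in> V' - {x}" using y x r by (auto simp: z_def V'_def)
        moreover have "e = c {x, z}" using y hom[OF x _ r(1)] by (auto simp: z_def)
        ultimately show "e \<in> colors_at c V' x" unfolding colors_at_def by (rule rev_image_eqI)
      qed
      show "colors_at c V' x \<subseteq> colors_at c V x" using \<open>V' \<subset> V\<close> by (auto simp: colors_at_def)
    qed
    have "V' - {r} = V - M" using r by (auto simp: V'_def)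
    then have at_r: "colors_at c V' r = out" by (simp add: colors_at_def out_def)
    have at_M: "K - colors_at c V x = (K - out) - colors_at c M x" if "x \<in> M" for x
    proof -
      have "V - {x} = (V - M) \<union> (M - {x})" using MV that by auto
      then have "colors_at c V x = (\<lambda>y. c {x, y}) ` (V - M) \<union> colors_at c M x"
        by (simp add: colors_at_def image_Un)
      moreover have "(\<lambda>y. c {x, y}) ` (V - M) = out"
        unfolding out_def using that out_M by (intro image_cong) auto
      ultimately show ?thesis by auto
    qed
    \<comment> \<open>A color of \<open>out\<close> inside \<open>M\<close> would close a
      monochromatic triangle with a vertex outside \<open>M\<close>.\<close>
    have inner: "colors_on c M \<subseteq> K - out"
    proof -
      have "c {x, y} \<notin> out" if "x \<in> M" "y \<in> M" "x \<noteq> y" for x y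
      proof
        assume "c {x, y} \<in> out"
        then obtain u where u: "u \<in> V - M" "c {x, y} = c {r, u}" by (auto simp: out_def)
        then have "c {y, u} = c {x, y}" "c {x, u} = c {x, y}" using out_M that by simp_all
        moreover have "x \<in> V" "y \<in> V" "u \<in> V" "y \<noteq> u" "x \<noteq> u" using that u MV by auto
        ultimately show False using prems(3) that(3) unfolding monochromatic_free_def by metis
      qed
      moreover have "colors_on c M \<subseteq> K" using colors_on_mono[of M V c] MV prems(5) by blast
      ultimately show ?thesis unfolding colors_on_def by blast
    qed
    \<comment> \<open>By induction with the colors \<open>K - out\<close>, the weights on
      \<open>M\<close> sum up to at most the weight of \<open>r\<close> in
      \<open>V'\<close>.\<close>
    have "(\<Sum>x\<in>M. gr_bound m (card (K - colors_at c V x))) \<le> gr_bound m (card (K - out))"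
      using less.hyps[of M "K - out"] restrict[OF MV] prems(4) inner by (simp add: at_M cong: sum.cong)
    moreover have "(\<Sum>x\<in>V - M. gr_bound m (card (K - colors_at c V x))) + gr_bound m (card (K - out))
        = (\<Sum>x\<in>V'. gr_bound m (card (K - colors_at c V' x)))"
      unfolding V'_def using prems(1) r at_rest at_r by (simp add: V'_def)
    moreover have "\<dots> \<le> gr_bound m (card K)"
      using V' prems(4) by (intro less.hyps) simp_all
    moreover have "(\<Sum>x\<in>V. gr_bound m (card (K - colors_at c V x))) =
        (\<Sum>x\<in>V - M. gr_bound m (card (K - colors_at c V x))) + (\<Sum>x\<in>M. gr_bound m (card (K - colors_at c V x)))"
      by (rule sum.subset_diff) (use MV prems in auto)
    ultimately show ?thesis by linarith
  next
    case False
    then obtain a b where ab: "colors_on c V \<subseteq> {a, b}" using homogeneous_exists prems by metis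
    consider "V = {}" | x where "V = {x}" | x y where "V = {x, y}" "x \<noteq> y" | "3 \<le> card V"
    proof -
      have "card V = 0 \<or> card V = 1 \<or> card V = 2 \<or> 3 \<le> card V" by linarith
      then show thesis using that prems(1) by (auto simp: card_1_singleton_iff card_2_iff)
    qed
    then show ?thesis
    proof cases
      case 3
      have "c {x, y} \<in> K" using 3 prems(5) by (auto simp: colors_on_def)
      moreover have "colors_at c V x = {c {x, y}}" "colors_at c V y = {c {x, y}}"
        using 3 by (auto simp: colors_at_def insert_commute)
      moreover have "card K = Suc (card (K - {c {x, y}}))"
        using \<open>c {x, y} \<in> K\<close> prems(4) by (metis card.remove)
      ultimately show ?thesis using 3 gr_bound_double[of m "card (K - {c {x, y}})"] assms(1) by simp
    next
      case 4
      \<comment> \<open>If all edges at \<open>x\<close> had color \<open>e\<close>, then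
        \<open>V - {x}\<close> would be homogeneous. So each vertex sees both colors.\<close>
      have two: "\<exists>y\<in>V - {x}. c {x, y} \<noteq> e" if x: "x \<in> V" for x e
      proof (rule ccontr)
        assume *: "\<not> ?thesis"
        have "\<exists>u\<in>V - {x}. \<exists>w\<in>V - {x}. u \<noteq> w"
        proof (rule ccontr)
          assume "\<not> ?thesis"
          then have "card (V - {x}) \<le> Suc 0" using prems(1) by (subst card_le_Suc0_iff_eq) auto
          then show False using 4 x prems(1) by simp
        qed
        then have "homogeneous c V (V - {x})" using * x unfolding homogeneous_def by auto
        then show False using False by blast
      qed
      have at: "colors_at c V x = {a, b} \<and> a \<noteq> b" if x: "x \<in> V" for x
      proof -
        have sub: "colors_at c V x \<subseteq> {a, b}" using colors_at_subset[OF x, of c] ab by (rule subset_trans)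
        have *: "\<exists>e\<in>colors_at c V x. e \<noteq> f" for f using two[OF x, of f] by (auto simp: colors_at_def)
        show ?thesis using sub *[of a] *[of b] by auto
      qed
      have "V \<noteq> {}" using 4 by auto
      then obtain x where x: "x \<in> V" by blast
      have abK: "a \<in> K" "b \<in> K" using at[OF x] colors_at_subset[OF x, of c] prems(5) by blast+
      let ?N = "\<lambda>e. {y \<in> V - {x}. c {x, y} = e}"
      \<comment> \<open>One vertex and at most two neighbours in each of two colors: at most five
        vertices.\<close>
      have "V \<subseteq> insert x (?N a \<union> ?N b)"
        using ab x by (auto simp: colors_on_def)
      then have "card V \<le> card (insert x (?N a \<union> ?N b))" using prems(1) by (intro card_mono) auto
      also have "\<dots> \<le> Suc (card (?N a) + card (?N b))"
        using card_Un_le[of "?N a" "?N b"] by (simp add: card_insert_if prems(1))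
      also have "\<dots> \<le> 5"
        using card_color_nbrs_le_2[OF prems(3,1) ab x] card_color_nbrs_le_2[OF prems(3,1) _ x, of b a] ab
        by (simp add: insert_commute)
      finally have "card V \<le> 5" .
      have "card {a, b} = 2" using at[OF x] by simp
      moreover have "card {a, b} \<le> card K" using abK prems(4) by (intro card_mono) auto
      moreover have "card (K - {a, b}) = card K - card {a, b}" using abK by (intro card_Diff_subset) auto
      ultimately have K: "card K = Suc (Suc (card (K - {a, b})))" by linarith
      have "(\<Sum>x\<in>V. gr_bound m (card (K - colors_at c V x))) = card V * gr_bound m (card (K - {a, b}))"
        using at by simp
      also have "\<dots> \<le> 5 * gr_bound m (card (K - {a, b}))" using \<open>card V \<le> 5\<close> by (rule mult_le_mono1)
      also have "\<dots> \<le> gr_bound m (card K)" unfolding K by (rule gr_bound_five[OF assms(1)])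
      finally show ?thesis .
    qed (auto simp: colors_at_def)
  qed
qed

subsection \<open>The upper bound\<close>

text \<open>Put a vertex \<open>x\<close> of small degree into \<open>I\<close>, delete it together
  with its neighbours, at most \<open>w x\<close> vertices in all, and continue.\<close>

lemma greedy_independent:
  assumes "finite S" "\<And>x y. R x y \<Longrightarrow> R y x"
    and "\<And>U. U \<subseteq> S \<Longrightarrow> U \<noteq> {} \<Longrightarrow> \<exists>x\<in>U. deg_in R U x < w x"
  shows "\<exists>I\<subseteq>S. (\<forall>x\<in>I. \<forall>y\<in>I. x \<noteq> y \<longrightarrow> \<not> R x y) \<and> card S \<le> sum w I"
  using assms(1,3)
proof (induction "card S" arbitrary: S rule: less_induct)
  case less
  show ?case
  proof (cases "S = {}")
    case False
    then obtain x where x: "x \<in> S" "deg_in R S x < w x" using less.prems(2)[of S] by auto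
    define N where "N = insert x {y \<in> S. R x y}"
    have N: "N \<subseteq> S" "x \<in> N" "finite N" using x less.prems by (auto simp: N_def)
    then have "S - N \<subset> S" by auto
    then have "card (S - N) < card S" using less.prems by (intro psubset_card_mono)
    moreover have "\<exists>x\<in>U. deg_in R U x < w x" if "U \<subseteq> S - N" "U \<noteq> {}" for U
      using less.prems(2)[of U] that by auto
    ultimately have "\<exists>I\<subseteq>S - N. (\<forall>x\<in>I. \<forall>y\<in>I. x \<noteq> y \<longrightarrow> \<not> R x y) \<and> card (S - N) \<le> sum w I"
      using less.prems(1) by (intro less.hyps) auto
    then obtain I where I: "I \<subseteq> S - N" "\<And>x y. x \<in> I \<Longrightarrow> y \<in> I \<Longrightarrow> x \<noteq> y \<Longrightarrow> \<not> R x y"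
      "card (S - N) \<le> sum w I" by blast
    have "finite I" using I less.prems by (meson finite_Diff finite_subset)
    have "card N \<le> Suc (deg_in R S x)"
      unfolding N_def deg_in_def using less.prems by (simp add: card_insert_if)
    then have "card S \<le> sum w I + w x"
      using I(3) x N card_Diff_subset[of N S] card_mono[OF less.prems(1) N(1)] by simp
    moreover have "x \<notin> I" "\<not> R x y" "\<not> R y x" if "y \<in> I" for y
      using I(1) that assms(2)[of y x] by (auto simp: N_def)
    ultimately have "(\<forall>u\<in>insert x I. \<forall>v\<in>insert x I. u \<noteq> v \<longrightarrow> \<not> R u v) \<and> card S \<le> sum w (insert x I)"
      using I(1,2) \<open>finite I\<close> N by (cases "x \<in> I") auto
    then show ?thesis using I(1) x by (intro exI[of _ "insert x I"]) auto
  qed auto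
qed

lemma card_le_gr_bound:
  fixes c :: "'a set \<Rightarrow> 'b"
  assumes fin: "finite V" and rf: "rainbow_free c V" and m: "3 \<le> m"
    and short: "\<And>i xs. lollipop (\<lambda>x y. (x, y) \<in> color_rel c V i) xs \<Longrightarrow> length xs \<le> m"
  shows "card V \<le> gr_bound m (card (colors_on c V))"
proof -
  define adj where "adj i x y \<longleftrightarrow> (x, y) \<in> color_rel c V i" for i x y
  define K where "K = colors_on c V"
  define Z where "Z i = {x. \<exists>xs. lollipop (adj i) xs \<and> last xs = x}" for i
  define D where "D x = {i \<in> K. x \<in> Z i}" for x
  \<comment> \<open>Asymmetric in form, but symmetric by \<open>Z_step\<close>.\<close>
  define R where "R x y \<longleftrightarrow> x \<in> V \<and> y \<in> V \<and> x \<noteq> y \<and> x \<in> Z (c {x, y})" for x y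
  have "K \<subseteq> c ` (\<lambda>(x, y). {x, y}) ` (V \<times> V)" by (auto simp: K_def colors_on_def)
  then have finK: "finite K" by (rule finite_subset) (use fin in auto)
  have adj_sym: "adj i x y \<Longrightarrow> adj i y x" and adj_irr: "\<not> adj i x x" for i x y
    by (auto simp: adj_def color_rel_def insert_commute)
  have adj_short: "lollipop (adj i) xs \<Longrightarrow> length xs \<le> m" for i xs
    using short[of i xs] by (simp add: adj_def[abs_def])
  \<comment> \<open>\<open>Z i\<close> is a union of components of color \<open>i\<close>: the
    lollipop is prolonged by \<open>y\<close>, or cut at \<open>y\<close>, or, if \<open>y\<close>
    is one of its first two vertices, replaced by its triangle ending there.\<close>
  have Z_step: "y \<in> Z i" if x: "x \<in> Z i" and xy: "adj i x y" for i x y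
  proof -
    obtain xs where xs: "lollipop (adj i) xs" "last xs = x" using x by (auto simp: Z_def)
    have ys: "\<exists>ys. lollipop (adj i) ys \<and> last ys = y"
    proof (cases "y \<in> set xs")
      case False
      then show ?thesis using xs xy by (intro exI[of _ "xs @ [y]"]) (auto intro: lollipop_snoc)
    next
      case True
      then obtain j where j: "j < length xs" "xs ! j = y" by (auto simp: in_set_conv_nth)
      show ?thesis
      proof (cases "2 \<le> j")
        case True
        then have "lollipop (adj i) (take (Suc j) xs)" by (intro lollipop_take xs) simp
        moreover have "last (take (Suc j) xs) = y" using j by (simp add: take_Suc_conv_app_nth)
        ultimately show ?thesis by blast
      next
        case False
        obtain p q r zs where pqr: "xs = p # q # r # zs" using lollipop_cases[OF xs(1)] .
        have t: "adj i p q" "adj i q r" "adj i p r" "distinct [p, q, r]"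
          using xs(1) unfolding pqr lollipop_Cons3 by auto
        have "lollipop (adj i) [q, r, p]" "lollipop (adj i) [p, r, q]"
          unfolding lollipop_Cons3 using t t(1-3)[THEN adj_sym] by auto
        moreover have "y = p \<or> y = q" using j False pqr by (auto simp: not_le less_2_cases_iff)
        ultimately show ?thesis by (metis last.simps list.distinct(1))
      qed
    qed
    then show ?thesis by (simp add: Z_def)
  qed
  have R_sym: "R y x" if "R x y" for x y
    using that Z_step[of x "c {x, y}" y] by (auto simp: R_def adj_def color_rel_def insert_commute)
  \<comment> \<open>Averaging: on \<open>U \<inter> Z i\<close> the degrees in color
    \<open>i\<close> average below \<open>m\<close>, so some \<open>x\<close> has fewer than
    \<open>m * card (D x)\<close> neighbours under \<open>R\<close>. A vertex with
    \<open>D x = {}\<close> has none, and weight 1.\<close>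
  have pick: "\<exists>x\<in>U. deg_in R U x < gr_bound m (card (D x))" if U: "U \<subseteq> V" "U \<noteq> {}" for U
  proof (cases "\<exists>x\<in>U. D x = {}")
    case True
    then obtain x where x: "x \<in> U" "D x = {}" by blast
    have "\<not> R x y" for y using x(2) by (auto simp: R_def D_def K_def colors_on_def)
    then show ?thesis using x by (intro bexI[of _ x]) (auto simp: deg_in_def)
  next
    case False
    have finU: "finite U" using U fin finite_subset by blast
    have finD: "finite (D x)" for x using finK by (simp add: D_def)
    have dR: "deg_in R U x \<le> (\<Sum>i\<in>D x. deg_in (adj i) U x)" for x
    proof -
      have "{y \<in> U. R x y} \<subseteq> (\<Union>i\<in>D x. {y \<in> U. adj i x y})"
        by (auto simp: R_def D_def K_def colors_on_def adj_def color_rel_def)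
      then have "deg_in R U x \<le> card (\<Union>i\<in>D x. {y \<in> U. adj i x y})"
        unfolding deg_in_def using finU finD by (intro card_mono) auto
      also have "\<dots> \<le> (\<Sum>i\<in>D x. deg_in (adj i) U x)"
        unfolding deg_in_def by (rule card_UN_le[OF finD])
      finally show ?thesis .
    qed
    have swap: "(\<Sum>x\<in>U. \<Sum>i\<in>D x. f i x) = (\<Sum>i\<in>K. \<Sum>x\<in>U \<inter> Z i. f i x)" for f :: "'b \<Rightarrow> 'a \<Rightarrow> nat"
    proof -
      have "(\<Sum>x\<in>U. \<Sum>i\<in>D x. f i x) = (\<Sum>x\<in>U. \<Sum>i\<in>K. if x \<in> Z i then f i x else 0)"
        unfolding D_def by (simp add: sum.inter_filter finK)
      also have "\<dots> = (\<Sum>i\<in>K. \<Sum>x\<in>U. if x \<in> Z i then f i x else 0)" by (rule sum.swap)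
      also have "\<dots> = (\<Sum>i\<in>K. \<Sum>x\<in>U \<inter> Z i. f i x)"
        by (simp add: sum.inter_restrict[symmetric] finU)
      finally show ?thesis .
    qed
    have less: "(\<Sum>x\<in>U \<inter> Z i. deg_in (adj i) U x) < m * card (U \<inter> Z i)" if "U \<inter> Z i \<noteq> {}" for i
    proof -
      have "deg_in (adj i) U x = deg_in (adj i) (U \<inter> Z i) x" if "x \<in> Z i" for x
        unfolding deg_in_def using Z_step[OF that] by (intro arg_cong[where f = card]) auto
      then have "(\<Sum>x\<in>U \<inter> Z i. deg_in (adj i) U x) = (\<Sum>x\<in>U \<inter> Z i. deg_in (adj i) (U \<inter> Z i) x)"
        by simp
      also have "\<dots> < m * card (U \<inter> Z i)"
        using finU that by (intro sum_deg_in_less[OF adj_sym adj_irr adj_short]) (auto simp: Z_def)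
      finally show ?thesis .
    qed
    obtain x0 i0 where "x0 \<in> U" "i0 \<in> D x0" using U False by blast
    then have i0: "i0 \<in> K" "U \<inter> Z i0 \<noteq> {}" by (auto simp: D_def)
    have "(\<Sum>i\<in>K. \<Sum>x\<in>U \<inter> Z i. deg_in (adj i) U x) < (\<Sum>i\<in>K. m * card (U \<inter> Z i))"
    proof (rule sum_strict_mono_ex1[OF finK])
      show "\<forall>i\<in>K. (\<Sum>x\<in>U \<inter> Z i. deg_in (adj i) U x) \<le> m * card (U \<inter> Z i)"
      proof
        fix i show "(\<Sum>x\<in>U \<inter> Z i. deg_in (adj i) U x) \<le> m * card (U \<inter> Z i)"
          using less[of i] by (cases "U \<inter> Z i = {}") auto
      qed
      show "\<exists>i\<in>K. (\<Sum>x\<in>U \<inter> Z i. deg_in (adj i) U x) < m * card (U \<inter> Z i)"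
        using less i0 by blast
    qed
    also have "\<dots> = (\<Sum>x\<in>U. m * card (D x))"
      using swap[of "\<lambda>i x. m"] by (simp add: mult.commute)
    finally have "(\<Sum>x\<in>U. \<Sum>i\<in>D x. deg_in (adj i) U x) < (\<Sum>x\<in>U. m * card (D x))"
      using swap[of "\<lambda>i. deg_in (adj i) U"] by simp
    then obtain x where x: "x \<in> U" "(\<Sum>i\<in>D x. deg_in (adj i) U x) < m * card (D x)"
      by (meson not_le sum_mono)
    then show ?thesis
      using dR[of x] gr_bound_ge[of m "card (D x)"] by (intro bexI[of _ x]) auto
  qed
  obtain I where I: "I \<subseteq> V" "\<And>x y. x \<in> I \<Longrightarrow> y \<in> I \<Longrightarrow> x \<noteq> y \<Longrightarrow> \<not> R x y"
    and cI: "card V \<le> (\<Sum>x\<in>I. gr_bound m (card (D x)))"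
    using greedy_independent[OF fin R_sym pick] by auto
  \<comment> \<open>A monochromatic triangle in \<open>I\<close> puts its own vertices into
    \<open>Z i\<close> for its color \<open>i\<close>, so they would be related by
    \<open>R\<close>.\<close>
  have mf: "monochromatic_free c I"
    unfolding monochromatic_free_def
  proof (intro ballI impI notI)
    fix x y z assume xyz: "x \<in> I" "y \<in> I" "z \<in> I" "x \<noteq> y" "y \<noteq> z" "x \<noteq> z"
      and eq: "c {x, y} = c {y, z} \<and> c {y, z} = c {x, z}"
    have "lollipop (adj (c {x, y})) [y, z, x]"
      using xyz eq I(1) by (auto simp: lollipop_Cons3 adj_def color_rel_def insert_commute)
    then have "x \<in> Z (c {x, y})" unfolding Z_def by force
    then have "R x y" using xyz I(1) by (auto simp: R_def)
    then show False using I(2) xyz by blast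
  qed
  \<comment> \<open>Edges inside \<open>I\<close> avoid \<open>R\<close>, so their colors at
    \<open>x\<close> are not in \<open>D x\<close>; passing to all missing colors only increases the
    weights.\<close>
  have sub: "D x \<subseteq> K - colors_at c I x" if "x \<in> I" for x
  proof -
    have "c {x, y} \<notin> D x" if "y \<in> I" "y \<noteq> x" for y
      using I(2)[OF \<open>x \<in> I\<close> that(1)] that \<open>x \<in> I\<close> I(1) by (auto simp: R_def D_def)
    then show ?thesis by (auto simp: colors_at_def D_def)
  qed
  have "(\<Sum>x\<in>I. gr_bound m (card (D x))) \<le> (\<Sum>x\<in>I. gr_bound m (card (K - colors_at c I x)))"
    using sub finK m by (intro sum_mono gr_bound_mono card_mono) auto
  also have "\<dots> \<le> gr_bound m (card K)"
    using I(1) m mf finK colors_on_mono[OF I(1), of c] finite_subset[OF I(1) fin]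
    by (intro sum_gr_bound_le rainbow_free_mono[OF rf]) (auto simp: K_def)
  finally show ?thesis using cI by (simp add: K_def)
qed

subsection \<open>The lower bound\<close>

lemma edges_complete_graph: "edges (complete_graph n) = {{x, y} | x y. x \<in> {1..n} \<and> y \<in> {1..n} \<and> x \<noteq> y}"
  by (auto simp: complete_graph_def elim!: nsets2_E) blast

lemma image_edges_complete_graph: "c ` edges (complete_graph n) = colors_on c {1..n}"
  unfolding edges_complete_graph colors_on_def by blast

lemma verts_triangle: "verts (complete_graph 3) = {1, 2, 3}"
  by (auto simp: complete_graph_def)

lemma edges_triangle: "edges (complete_graph 3) = {{1, 2}, {2, 3}, {1, 3}}"
proof
  have "{1..3} = {1, 2, 3::nat}" by auto
  then show "edges (complete_graph 3) \<subseteq> {{1, 2}, {2, 3}, {1, 3}}"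
    unfolding edges_complete_graph by (auto simp: insert_commute)
qed (auto simp: complete_graph_def)

lemma rainbow_copy_iff:
  "(\<exists>f. rainbow_copy c f (complete_graph 3) (complete_graph n)) \<longleftrightarrow> \<not> rainbow_free c {1..n}"
proof
  assume "\<exists>f. rainbow_copy c f (complete_graph 3) (complete_graph n)"
  then obtain f where f: "rainbow_copy c f (complete_graph 3) (complete_graph n)" by blast
  have inj: "inj_on f {1..3}" and V: "f ` {1..3} \<subseteq> {1..n}"
    and c: "inj_on (\<lambda>e. c (f ` e)) {{1, 2}, {2, 3}, {1, 3::nat}}"
    using f unfolding rainbow_copy_def is_copy_def edges_triangle by (auto simp: complete_graph_def)
  have "f 1 \<noteq> f 2" "f 2 \<noteq> f 3" "f 1 \<noteq> f 3"
    using inj_on_eq_iff[OF inj, of 1 2] inj_on_eq_iff[OF inj, of 2 3] inj_on_eq_iff[OF inj, of 1 3] by simp_all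
  moreover have "f 1 \<in> {1..n}" "f 2 \<in> {1..n}" "f 3 \<in> {1..n}" using V by (auto simp: image_subset_iff)
  moreover have "c (f ` {1, 2}) \<noteq> c (f ` {2, 3})" "c (f ` {2, 3}) \<noteq> c (f ` {1, 3})"
      "c (f ` {1, 2}) \<noteq> c (f ` {1, 3})"
    using c[THEN inj_onD, of "{1, 2}" "{2, 3}"] c[THEN inj_onD, of "{2, 3}" "{1, 3}"]
      c[THEN inj_onD, of "{1, 2}" "{1, 3}"] by (auto simp: doubleton_eq_iff)
  ultimately show "\<not> rainbow_free c {1..n}"
    using rainbow_freeD[of c "{1..n}" "f 1" "f 2" "f 3"] by auto
next
  assume "\<not> rainbow_free c {1..n}"
  then obtain x y z where xyz: "x \<in> {1..n}" "y \<in> {1..n}" "z \<in> {1..n}" "x \<noteq> y" "y \<noteq> z" "x \<noteq> z"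
    "c {x, y} \<noteq> c {y, z}" "c {y, z} \<noteq> c {x, z}" "c {x, y} \<noteq> c {x, z}"
    unfolding rainbow_free_def by blast
  define f where "f i = (if i = 1 then x else if i = 2 then y else z)" for i :: nat
  have f: "f 1 = x" "f 2 = y" "f 3 = z" by (auto simp: f_def)
  have "rainbow_copy c f (complete_graph 3) (complete_graph n)"
    unfolding rainbow_copy_def is_copy_def edges_triangle
  proof (intro conjI)
    show "inj_on f (verts (complete_graph 3))" "f ` verts (complete_graph 3) \<subseteq> verts (complete_graph n)"
      unfolding verts_triangle using xyz f by (auto simp: complete_graph_def)
    show "\<forall>e\<in>{{1, 2}, {2, 3}, {1, 3}}. f ` e \<in> edges (complete_graph n)"
      using xyz f unfolding edges_complete_graph by auto
    show "inj_on (\<lambda>e. c (f ` e)) {{1, 2}, {2, 3}, {1, 3}}"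
      using xyz f by (auto simp: inj_on_def)
  qed
  then show "\<exists>f. rainbow_copy c f (complete_graph 3) (complete_graph n)" by blast
qed

lemma edges_path_plus: "edges (path_plus t) = insert {1, 3} {{i, i + 1} | i. 1 \<le> i \<and> i < t}"
  by (simp add: path_plus_def path_graph_def)

lemma verts_path_plus: "verts (path_plus t) = {1..t}"
  by (simp add: path_plus_def path_graph_def)

lemma monochromatic_copy_iff:
  assumes "3 \<le> t"
  shows "(\<exists>f. monochromatic_copy c f (path_plus t) (complete_graph n)) \<longleftrightarrow>
    (\<exists>i xs. lollipop (\<lambda>x y. (x, y) \<in> color_rel c {1..n} i) xs \<and> length xs = t)"
proof
  assume "\<exists>f. monochromatic_copy c f (path_plus t) (complete_graph n)"
  then obtain f where "monochromatic_copy c f (path_plus t) (complete_graph n)" by blast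
  then have f: "inj_on f {1..t}" "f ` {1..t} \<subseteq> {1..n}"
    and "\<exists>a. \<forall>e \<in> edges (path_plus t). c (f ` e) = a"
    unfolding monochromatic_copy_def is_copy_def verts_path_plus by (simp_all add: complete_graph_def)
  then obtain a where a: "\<And>e. e \<in> edges (path_plus t) \<Longrightarrow> c (f ` e) = a" by blast
  have rel: "(f i, f j) \<in> color_rel c {1..n} a"
    if "{i, j} \<in> edges (path_plus t)" "i \<in> {1..t}" "j \<in> {1..t}" "i \<noteq> j" for i j
    using a[OF that(1)] that(2-) f(2) inj_onD[OF f(1), of i j]
    unfolding color_rel_def by (simp add: image_subset_iff) blast
  define xs where "xs = map f [1..<Suc t]"
  have "lollipop (\<lambda>x y. (x, y) \<in> color_rel c {1..n} a) xs"
    unfolding lollipop_def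
  proof (intro conjI)
    show "distinct xs"
      using f(1) by (simp add: xs_def distinct_map atLeastLessThanSuc_atLeastAtMost del: upt_Suc)
    show "successively (\<lambda>x y. (x, y) \<in> color_rel c {1..n} a) xs"
      unfolding successively_conv_nth
    proof (intro allI impI)
      fix i assume i: "Suc i < length xs"
      then have i': "Suc i < t" by (simp add: xs_def del: upt_Suc)
      then have "xs ! i = f (Suc i)" "xs ! Suc i = f (Suc (Suc i))" by (auto simp: xs_def nth_map_upt simp del: upt_Suc)
      moreover have "{Suc i, Suc (Suc i)} \<in> edges (path_plus t)" unfolding edges_path_plus using i' by auto
      ultimately show "(xs ! i, xs ! Suc i) \<in> color_rel c {1..n} a" using rel i' by simp
    qed
    have "xs ! 0 = f 1" "xs ! 2 = f 3" using assms by (auto simp: xs_def numeral_3_eq_3 simp del: upt_Suc)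
    moreover have "{1, 3} \<in> edges (path_plus t)" by (simp add: edges_path_plus)
    ultimately show "(xs ! 0, xs ! 2) \<in> color_rel c {1..n} a" using rel assms by simp
  qed (use assms in \<open>simp add: xs_def\<close>)
  then show "\<exists>i xs. lollipop (\<lambda>x y. (x, y) \<in> color_rel c {1..n} i) xs \<and> length xs = t"
    by (intro exI[of _ a] exI[of _ xs]) (simp add: xs_def)
next
  assume "\<exists>i xs. lollipop (\<lambda>x y. (x, y) \<in> color_rel c {1..n} i) xs \<and> length xs = t"
  then obtain i xs where xs: "lollipop (\<lambda>x y. (x, y) \<in> color_rel c {1..n} i) xs" "length xs = t" by blast
  \<comment> \<open>The vertices of \<open>path_plus t\<close> are numbered from 1, list positions
    from 0.\<close>
  define f where "f j = xs ! (j - 1)" for j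
  have succ: "(f j, f (j + 1)) \<in> color_rel c {1..n} i" if "1 \<le> j" "j < t" for j
  proof -
    have "Suc (j - 1) < length xs" using that xs by simp
    then have "(xs ! (j - 1), xs ! Suc (j - 1)) \<in> color_rel c {1..n} i"
      using xs(1) unfolding lollipop_def successively_conv_nth by blast
    then show ?thesis using that by (simp add: f_def)
  qed
  have tri: "(f 1, f 3) \<in> color_rel c {1..n} i" using xs by (simp add: lollipop_def f_def)
  have edge: "f ` e \<in> edges (complete_graph n) \<and> c (f ` e) = i" if e: "e \<in> edges (path_plus t)" for e
  proof -
    obtain p q where "e = {p, q}" "(f p, f q) \<in> color_rel c {1..n} i"
      using e succ tri unfolding edges_path_plus by blast
    then show ?thesis unfolding edges_complete_graph color_rel_def by auto
  qed
  have "f j \<in> {1..n}" if "j \<in> {1..t}" for j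
  proof (cases "j = t")
    case False
    then show ?thesis using succ[of j] that by (auto simp: color_rel_def)
  next
    case True
    then show ?thesis using succ[of "t - 1"] assms by (auto simp: color_rel_def)
  qed
  moreover have "inj_on f {1..t}"
    using xs by (auto simp: inj_on_def f_def lollipop_def nth_eq_iff_index_eq)
  ultimately have "monochromatic_copy c f (path_plus t) (complete_graph n)"
    using edge unfolding monochromatic_copy_def is_copy_def verts_path_plus
    by (auto simp: complete_graph_def)
  then show "\<exists>f. monochromatic_copy c f (path_plus t) (complete_graph n)" by blast
qed

lemma gallai_ramsey_prop_iff:
  assumes "3 \<le> t"
  shows "gallai_ramsey_prop k (complete_graph 3) (path_plus t) n \<longleftrightarrow>
    (\<forall>c :: nat set \<Rightarrow> nat. card (colors_on c {1..n}) \<le> k \<longrightarrow> rainbow_free c {1..n} \<longrightarrow>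
      (\<exists>i xs. lollipop (\<lambda>x y. (x, y) \<in> color_rel c {1..n} i) xs \<and> length xs = t))"
  unfolding gallai_ramsey_prop_def image_edges_complete_graph rainbow_copy_iff
    monochromatic_copy_iff[OF assms] by blast

section \<open>Extremal colorings by blow-up\<close>

lemma lollipop_map:
  assumes "lollipop adj xs" "\<And>x y. x \<in> set xs \<Longrightarrow> y \<in> set xs \<Longrightarrow> adj x y \<Longrightarrow> adj' (h x) (h y)"
    "inj_on h (set xs)"
  shows "lollipop adj' (map h xs)"
proof -
  have "0 < length xs" "2 < length xs" using assms(1) by (auto simp: lollipop_def)
  then show ?thesis
    using assms unfolding lollipop_def by (auto simp: distinct_map successively_conv_nth)
qed

lemma set_lollipop_subset:
  assumes "lollipop (\<lambda>x y. (x, y) \<in> color_rel c V i) xs"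
  shows "set xs \<subseteq> V"
proof
  fix x assume "x \<in> set xs"
  then obtain j where j: "j < length xs" "x = xs ! j" by (auto simp: in_set_conv_nth)
  have len: "3 \<le> length xs" using assms by (simp add: lollipop_def)
  have succ: "xs ! l \<in> V \<and> xs ! Suc l \<in> V" if "Suc l < length xs" for l
    using assms that unfolding lollipop_def successively_conv_nth color_rel_def by blast
  show "x \<in> V"
  proof (cases "Suc j < length xs")
    case True
    then show ?thesis using succ j by simp
  next
    case False
    then have "Suc (j - 1) < length xs" "Suc (j - 1) = j" using j len by simp_all
    then show ?thesis using succ[of "j - 1"] j by simp
  qed
qed

text \<open>Vertices and colors count from 0, so that \<open>div\<close> and \<open>mod\<close> can
  address a blow-up. For \<open>t >= 3\<close>, excluding all lengths from \<open>t\<close> on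
  amounts to excluding length \<open>t\<close>, by cutting.\<close>

definition avoiding_coloring :: "nat \<Rightarrow> nat \<Rightarrow> nat \<Rightarrow> (nat set \<Rightarrow> nat) \<Rightarrow> bool" where
  "avoiding_coloring t k n c \<longleftrightarrow> rainbow_free c {..<n} \<and> colors_on c {..<n} \<subseteq> {..<k} \<and>
     (\<forall>i xs. lollipop (\<lambda>x y. (x, y) \<in> color_rel c {..<n} i) xs \<longrightarrow> length xs < t)"

lemma avoiding_coloring_clique:
  assumes "1 \<le> t"
  shows "avoiding_coloring t 1 (t - 1) (\<lambda>e. 0)"
proof -
  have "length xs < t" if xs: "lollipop (\<lambda>x y. (x, y) \<in> color_rel (\<lambda>e. 0::nat) {..<t - 1} i) xs" for i xs
  proof -
    have "set xs \<subseteq> {..<t - 1}" using xs by (rule set_lollipop_subset)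
    then have "card (set xs) \<le> t - 1" using card_mono[of "{..<t - 1}" "set xs"] by simp
    then show ?thesis using xs assms by (simp add: lollipop_def distinct_card)
  qed
  then show ?thesis
    by (auto simp: avoiding_coloring_def rainbow_free_def colors_on_def)
qed

text \<open>Vertex \<open>x\<close> stands for vertex \<open>x mod n\<close> of copy number
  \<open>x div n\<close>. An edge lies inside a copy if its image under \<open>div\<close> is a
  singleton; the shift by \<open>k\<close> keeps the two sets of colors apart.\<close>

definition blow_up :: "nat \<Rightarrow> nat \<Rightarrow> (nat set \<Rightarrow> nat) \<Rightarrow> (nat set \<Rightarrow> nat) \<Rightarrow> nat set \<Rightarrow> nat" where
  "blow_up k n c d e = (if card ((\<lambda>x. x div n) ` e) = 1 then c ((\<lambda>x. x mod n) ` e)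
     else k + d ((\<lambda>x. x div n) ` e))"

lemma blow_up_pair:
  "blow_up k n c d {x, y} = (if x div n = y div n then c {x mod n, y mod n} else k + d {x div n, y div n})"
  by (simp add: blow_up_def)

text \<open>Colors below \<open>k\<close> occur only inside copies, so their lollipops stay in one
  copy and project to lollipops of \<open>c\<close>. The other colors contain no triangle, as it
  would project to a monochromatic one of \<open>d\<close>. A triangle meeting exactly two copies
  has two edges of equal color.\<close>

lemma avoiding_coloring_blow_up:
  assumes c: "avoiding_coloring t k n c" and n: "0 < n" and t: "3 \<le> t"
    and d: "rainbow_free d {..<q}" "monochromatic_free d {..<q}" "colors_on d {..<q} \<subseteq> {..<j}"
  shows "avoiding_coloring t (k + j) (q * n) (blow_up k n c d)"
proof -
  let ?b = "blow_up k n c d"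
  have div: "x div n < q" "x mod n < n" if "x < q * n" for x
    using that n by (auto simp: less_mult_imp_div_less)
  have eqI: "x = y" if "x div n = y div n" "x mod n = y mod n" for x y
    using that by (metis div_mult_mod_eq)
  have cK: "c {x, y} < k" if "x < n" "y < n" "x \<noteq> y" for x y
    using c that by (auto simp: avoiding_coloring_def colors_on_def)
  have dK: "d {x, y} < j" if "x < q" "y < q" "x \<noteq> y" for x y
    using d(3) that by (auto simp: colors_on_def)
  have modne: "x mod n \<noteq> y mod n" if "x div n = y div n" "x \<noteq> y" for x y using eqI that by blast
  have rf: "rainbow_free ?b {..<q * n}"
    unfolding rainbow_free_def
  proof (intro ballI impI)
    fix x y z assume xyz: "x \<in> {..<q * n}" "y \<in> {..<q * n}" "z \<in> {..<q * n}" "x \<noteq> y" "y \<noteq> z" "x \<noteq> z"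
    consider "x div n = y div n" "y div n = z div n" | "x div n = y div n" "y div n \<noteq> z div n"
      | "y div n = z div n" "x div n \<noteq> y div n" | "x div n = z div n" "y div n \<noteq> z div n"
      | "x div n \<noteq> y div n" "y div n \<noteq> z div n" "x div n \<noteq> z div n" by metis
    then show "?b {x, y} = ?b {y, z} \<or> ?b {y, z} = ?b {x, z} \<or> ?b {x, y} = ?b {x, z}"
    proof cases
      case 1
      have "rainbow_free c {..<n}" using c by (simp add: avoiding_coloring_def)
      from this[unfolded rainbow_free_def, rule_format, of "x mod n" "y mod n" "z mod n"]
      show ?thesis using 1 xyz n modne[of x y] modne[of y z] modne[of x z] by (simp add: blow_up_pair)
    next
      case 5
      from d(1)[unfolded rainbow_free_def, rule_format, of "x div n" "y div n" "z div n"]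
      show ?thesis using 5 xyz div by (simp add: blow_up_pair)
    qed (auto simp: blow_up_pair insert_commute)
  qed
  have cols: "colors_on ?b {..<q * n} \<subseteq> {..<k + j}"
  proof
    fix e assume "e \<in> colors_on ?b {..<q * n}"
    then obtain x y where xy: "x < q * n" "y < q * n" "x \<noteq> y" "e = ?b {x, y}" by (auto simp: colors_on_def)
    show "e \<in> {..<k + j}"
    proof (cases "x div n = y div n")
      case True
      then show ?thesis using cK[of "x mod n" "y mod n"] modne[of x y] xy n
        by (simp add: blow_up_pair trans_less_add1)
    next
      case False
      then show ?thesis using dK[of "x div n" "y div n"] div xy by (simp add: blow_up_pair)
    qed
  qed
  have "length xs < t" if xs: "lollipop (\<lambda>x y. (x, y) \<in> color_rel ?b {..<q * n} i) xs" for i xs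
  proof (cases "i < k")
    case True
    have rel: "x div n = y div n \<and> (x mod n, y mod n) \<in> color_rel c {..<n} i"
      if "(x, y) \<in> color_rel ?b {..<q * n} i" for x y
      using that True n modne[of x y] by (auto simp: color_rel_def blow_up_pair split: if_splits)
    have succ: "(xs ! j, xs ! Suc j) \<in> color_rel ?b {..<q * n} i" if "Suc j < length xs" for j
      using xs that unfolding lollipop_def successively_conv_nth by blast
    have "xs ! j div n = xs ! 0 div n" if "j < length xs" for j
      using that
    proof (induction j)
      case (Suc j)
      then show ?case using rel[OF succ[of j]] by simp
    qed simp
    then have "\<forall>x\<in>set xs. x div n = xs ! 0 div n" by (auto simp: in_set_conv_nth)
    then have "inj_on (\<lambda>x. x mod n) (set xs)" by (intro inj_onI) (rule eqI; simp)
    then have "lollipop (\<lambda>x y. (x, y) \<in> color_rel c {..<n} i) (map (\<lambda>x. x mod n) xs)"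
      using rel by (intro lollipop_map[OF xs]) auto
    then have "length (map (\<lambda>x. x mod n) xs) < t" using c unfolding avoiding_coloring_def by blast
    then show ?thesis by simp
  next
    case False
    obtain x y z zs where "xs = x # y # z # zs" using lollipop_cases[OF xs] .
    then have "(x, y) \<in> color_rel ?b {..<q * n} i" "(y, z) \<in> color_rel ?b {..<q * n} i"
      "(x, z) \<in> color_rel ?b {..<q * n} i"
      using xs by (auto simp: lollipop_Cons3)
    moreover have "u div n \<noteq> v div n \<and> u div n < q \<and> v div n < q \<and> d {u div n, v div n} = i - k"
      if "(u, v) \<in> color_rel ?b {..<q * n} i" for u v
    proof -
      have uv: "u < q * n" "v < q * n" "u \<noteq> v" "?b {u, v} = i" using that by (auto simp: color_rel_def)
      have "u div n \<noteq> v div n"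
      proof
        assume *: "u div n = v div n"
        then have "c {u mod n, v mod n} < k" using n uv modne by (intro cK) auto
        then show False using uv * False by (simp add: blow_up_pair)
      qed
      then show ?thesis using uv div by (auto simp: blow_up_pair)
    qed
    ultimately have "x div n \<noteq> y div n" "y div n \<noteq> z div n" "x div n \<noteq> z div n"
      "x div n \<in> {..<q}" "y div n \<in> {..<q}" "z div n \<in> {..<q}"
      "d {x div n, y div n} = i - k" "d {y div n, z div n} = i - k" "d {x div n, z div n} = i - k"
      by blast+
    then show ?thesis using d(2) unfolding monochromatic_free_def by metis
  qed
  then show ?thesis using rf cols unfolding avoiding_coloring_def by blast
qed

text \<open>On \<open>{..<5}\<close> the differences 1 and 4 are the steps by one modulo 5, so color
  0 is a 5-cycle and color 1 the complementary 5-cycle.\<close>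

definition pentagon :: "nat set \<Rightarrow> nat" where
  "pentagon e = (if Max e - Min e \<in> {1, 4} then 0 else 1)"

lemma pentagon_properties:
  "rainbow_free pentagon {..<5}" "monochromatic_free pentagon {..<5}" "colors_on pentagon {..<5} \<subseteq> {..<2}"
proof -
  have "pentagon e = 0 \<or> pentagon e = 1" for e by (simp add: pentagon_def)
  then show "rainbow_free pentagon {..<5}" unfolding rainbow_free_def by metis
  have "pentagon e < 2" for e by (simp add: pentagon_def)
  then show "colors_on pentagon {..<5} \<subseteq> {..<2}" by (auto simp: colors_on_def)
  have five: "{..<5::nat} = {0, 1, 2, 3, 4}" by auto
  show "monochromatic_free pentagon {..<5}"
    unfolding monochromatic_free_def five by (simp add: pentagon_def)
qed

text \<open>Follows the recursion of \<open>gr_bound\<close>: a clique on \<open>t - 1\<close>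
  vertices, two copies of it for a second color, then five copies joined along
  \<open>pentagon\<close> for every two further colors.\<close>

lemma avoiding_coloring_exists:
  assumes "4 \<le> t" "1 \<le> k"
  shows "\<exists>c. avoiding_coloring t k (gr_bound (t - 1) k) c"
  using assms(2)
proof (induction "t - 1" k rule: gr_bound.induct)
  case 2
  then show ?case using avoiding_coloring_clique[of t] assms(1) by auto
next
  case 3
  have "rainbow_free (\<lambda>e. 0) {..<2::nat}" "monochromatic_free (\<lambda>e. 0::nat) {..<2::nat}"
    "colors_on (\<lambda>e. 0::nat) {..<2::nat} \<subseteq> {..<1}"
    by (auto simp: rainbow_free_def monochromatic_free_def colors_on_def)
  from avoiding_coloring_blow_up[OF avoiding_coloring_clique[of t] _ _ this]
  show ?case using assms(1) by (auto simp: numeral_2_eq_2)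
next
  case (4 k)
  then obtain c where c: "avoiding_coloring t (Suc k) (gr_bound (t - 1) (Suc k)) c" by auto
  have "(t - 1) * Suc k \<le> gr_bound (t - 1) (Suc k)" by (rule gr_bound_ge)
  moreover have "0 < (t - 1) * Suc k" using assms(1) by simp
  ultimately have "0 < gr_bound (t - 1) (Suc k)" by (rule order.strict_trans2[rotated])
  from avoiding_coloring_blow_up[OF c this _ pentagon_properties]
  show ?case using assms(1) by auto
qed simp

section \<open>The exact value\<close>

theorem theorem12:
  fixes t k :: nat
  assumes "t \<ge> 4" and "k \<ge> 1"
  shows "gallai_ramsey k (complete_graph 3) (path_plus t) =
           (if even k then 2 * (t - 1) * 5 ^ ((k - 2) div 2) + 1
            else (t - 1) * 5 ^ ((k - 1) div 2) + 1)"
proof -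
  define N where "N = gr_bound (t - 1) k"
  have t: "3 \<le> t" "3 \<le> t - 1" using assms by auto
  have upper: "gallai_ramsey_prop k (complete_graph 3) (path_plus t) (N + 1)"
    unfolding gallai_ramsey_prop_iff[OF t(1)]
  proof (intro allI impI, rule ccontr)
    fix c :: "nat set \<Rightarrow> nat"
    assume k: "card (colors_on c {1..N + 1}) \<le> k" and rf: "rainbow_free c {1..N + 1}"
      and none: "\<nexists>i xs. lollipop (\<lambda>x y. (x, y) \<in> color_rel c {1..N + 1} i) xs \<and> length xs = t"
    \<comment> \<open>A longer lollipop could be cut to exactly \<open>t\<close> vertices.\<close>
    have "length xs \<le> t - 1" if "lollipop (\<lambda>x y. (x, y) \<in> color_rel c {1..N + 1} i) xs" for i xs
    proof (rule ccontr)
      assume "\<not> ?thesis"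
      then have "length (take t xs) = t" by simp
      then show False using none lollipop_take[OF that t(1)] by blast
    qed
    then have "card {1..N + 1} \<le> gr_bound (t - 1) (card (colors_on c {1..N + 1}))"
      using rf t by (intro card_le_gr_bound) auto
    also have "\<dots> \<le> gr_bound (t - 1) k" using k t by (intro gr_bound_mono) auto
    finally show False by (simp add: N_def)
  qed
  have lower: "N + 1 \<le> n" if n: "gallai_ramsey_prop k (complete_graph 3) (path_plus t) n" for n
  proof (rule ccontr)
    assume "\<not> ?thesis"
    then have nN: "n \<le> N" by simp
    obtain c where c: "avoiding_coloring t k N c"
      using avoiding_coloring_exists[OF assms] by (auto simp: N_def)
    \<comment> \<open>\<open>h\<close> maps \<open>{1..n}\<close> injectively into
      \<open>{..<N}\<close>, so the coloring on \<open>N\<close> vertices restricts to every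
      \<open>n <= N\<close>.\<close>
    define h :: "nat \<Rightarrow> nat" where "h x = x - 1" for x
    define c' where "c' e = c (h ` e)" for e
    have h: "h x < N" if "x \<in> {1..n}" for x using that nN by (auto simp: h_def)
    have hne: "h x \<noteq> h y" if "x \<in> {1..n}" "y \<in> {1..n}" "x \<noteq> y" for x y using that by (auto simp: h_def)
    have "colors_on c' {1..n} \<subseteq> colors_on c {..<N}"
    proof
      fix e assume "e \<in> colors_on c' {1..n}"
      then obtain x y where xy: "x \<in> {1..n}" "y \<in> {1..n}" "x \<noteq> y" "e = c' {x, y}"
        unfolding colors_on_def by blast
      then have "e = c {h x, h y}" "h x \<in> {..<N}" "h y \<in> {..<N}" "h x \<noteq> h y"
        using h hne by (simp_all add: c'_def)
      then show "e \<in> colors_on c {..<N}" unfolding colors_on_def by blast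
    qed
    then have "colors_on c' {1..n} \<subseteq> {..<k}" using c by (auto simp: avoiding_coloring_def)
    then have "card (colors_on c' {1..n}) \<le> k" using card_mono[of "{..<k}"] by fastforce
    moreover have "rainbow_free c' {1..n}"
      unfolding rainbow_free_def
    proof (intro ballI impI)
      fix x y z assume "x \<in> {1..n}" "y \<in> {1..n}" "z \<in> {1..n}" "x \<noteq> y" "y \<noteq> z" "x \<noteq> z"
      moreover have "rainbow_free c {..<N}" using c by (simp add: avoiding_coloring_def)
      ultimately show "c' {x, y} = c' {y, z} \<or> c' {y, z} = c' {x, z} \<or> c' {x, y} = c' {x, z}"
        using h hne unfolding rainbow_free_def c'_def by simp
    qed
    ultimately obtain i xs where xs: "lollipop (\<lambda>x y. (x, y) \<in> color_rel c' {1..n} i) xs" "length xs = t"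
      using n unfolding gallai_ramsey_prop_iff[OF t(1)] by blast
    have rel: "(h x, h y) \<in> color_rel c {..<N} i"
      if "(x, y) \<in> color_rel c' {1..n} i" for x y
      using that h[of x] h[of y] hne[of x y] by (simp add: color_rel_def c'_def)
    have "set xs \<subseteq> {1..n}" using xs(1) by (rule set_lollipop_subset)
    then have "inj_on h (set xs)" using hne by (metis inj_onI subsetD)
    then have "lollipop (\<lambda>x y. (x, y) \<in> color_rel c {..<N} i) (map h xs)"
      using rel by (intro lollipop_map[OF xs(1)]) blast+
    then have "length (map h xs) < t" using c unfolding avoiding_coloring_def by blast
    then show False using xs(2) by simp
  qed
  have "gallai_ramsey k (complete_graph 3) (path_plus t) = N + 1"
    unfolding gallai_ramsey_def using upper lower by (rule Least_equality)
  then show ?thesis using gr_bound_closed_form[OF assms(2), of "t - 1"] by (simp add: N_def)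
qed

end
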